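(* Fix a positive integer $r\geq 3$ and a real number $\varepsilon>0$. Then for all sufficiently large integers $k$ (depending on $r$ and $\varepsilon$), we have \[\operatorname{ind}_r(k,\ell)\leq \operatorname{ind}_{\leq r}(k,\ell)\leq 100\cdot \ell^{-1/(2r)}\] for all integers $\ell$ with $1\leq \ell\leq (1-\varepsilon)k/r$.
   Context: A hypergraph has a finite vertex set and a set of edges, each edge being a non-empty subset of the vertex set. For a hypergraph $G$ with at least $k$ vertices, let $I(G,k,\ell)$ be the probability that a uniformly random $k$-vertex subset of $V(G)$ contains (as subsets) exactly $\ell$ edges of $G$. For $r\geq 1$ and $n\geq k$, let $I_r(n,k,\ell)$ be the maximum of $I(G,k,\ell)$ over all $r$-uniform hypergraphs $G$ on $n$ vertices, and $I_{\leq r}(n,k,\ell)$ the maximum of $I(G,k,\ell)$ over all hypergraphs $G$ on $n$ vertices all of whose edges have size at most $r$. Both are non-increasing in $n$; define $\operatorname{ind}_r(k,\ell)=\lim_{n\to\infty}I_r(n,k,\ell)$ and $\operatorname{ind}_{\leq r}(k,\ell)=\lim_{n\to\infty}I_{\leq r}(n,k,\ell)$. *)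

theory Defs
  imports "HOL-Probability.Probability"
begin

definition hypergraph :: "'a set \<Rightarrow> 'a set set \<Rightarrow> bool" where
  "hypergraph V E \<longleftrightarrow> finite V \<and> (\<forall>e\<in>E. e \<subseteq> V \<and> e \<noteq> {})"

(* Meaningful for k \<le> card V only, since pmf_of_set needs a non-empty set. *)
definition edge_prob :: "'a set \<Rightarrow> 'a set set \<Rightarrow> nat \<Rightarrow> nat \<Rightarrow> real" where
  "edge_prob V E k l =
     measure_pmf.prob (pmf_of_set {S. S \<subseteq> V \<and> card S = k})
       {S. card {e \<in> E. e \<subseteq> S} = l}"

(* Every hypergraph on n vertices is isomorphic to one whose vertices are natural numbers,
   so the maxima may be taken over vertex sets of type nat set. *)
definition I_unif :: "nat \<Rightarrow> nat \<Rightarrow> nat \<Rightarrow> nat \<Rightarrow> real" where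
  "I_unif r n k l =
     Max {edge_prob V E k l | (V :: nat set) E.
            hypergraph V E \<and> card V = n \<and> (\<forall>e\<in>E. card e = r)}"

definition I_atmost :: "nat \<Rightarrow> nat \<Rightarrow> nat \<Rightarrow> nat \<Rightarrow> real" where
  "I_atmost r n k l =
     Max {edge_prob V E k l | (V :: nat set) E.
            hypergraph V E \<and> card V = n \<and> (\<forall>e\<in>E. card e \<le> r)}"

definition ind_unif :: "nat \<Rightarrow> nat \<Rightarrow> nat \<Rightarrow> real" where
  "ind_unif r k l = lim (\<lambda>n. I_unif r n k l)"

definition ind_atmost :: "nat \<Rightarrow> nat \<Rightarrow> nat \<Rightarrow> real" where
  "ind_atmost r k l = lim (\<lambda>n. I_atmost r n k l)"

text \<open>The maxima are attained and the limits exist; both are shown for an arbitrary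
  restriction \<open>P\<close> on the edges.\<close>

definition edge_probs :: "(nat set \<Rightarrow> bool) \<Rightarrow> nat \<Rightarrow> nat \<Rightarrow> nat \<Rightarrow> real set" where
  "edge_probs P n k l =
     {edge_prob V E k l | (V :: nat set) E. hypergraph V E \<and> card V = n \<and> (\<forall>e\<in>E. P e)}"

definition good_sets :: "'a set \<Rightarrow> 'a set set \<Rightarrow> nat \<Rightarrow> nat \<Rightarrow> 'a set set" where
  "good_sets V E k l = {S. S \<subseteq> V \<and> card S = k \<and> card {e \<in> E. e \<subseteq> S} = l}"

lemma edge_prob_eq:
  assumes "finite V" "k \<le> card V"
  shows "edge_prob V E k l = real (card (good_sets V E k l)) / real (card V choose k)"
proof -
  let ?A = "{S. S \<subseteq> V \<and> card S = k}"
  have card: "card ?A = card V choose k"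
    using n_subsets[OF assms(1)] by simp
  have ne: "?A \<noteq> {}"
    using obtain_subset_with_card_n[OF assms(2)] by blast
  have fin: "finite ?A"
    using assms(1) by simp
  have "?A \<inter> {S. card {e \<in> E. e \<subseteq> S} = l} = good_sets V E k l"
    by (auto simp: good_sets_def)
  then show ?thesis
    unfolding edge_prob_def measure_pmf_of_set[OF ne fin] card by simp
qed

lemma finite_good_sets: "finite V \<Longrightarrow> finite (good_sets V E k l)"
  by (rule finite_subset[of _ "Pow V"]) (auto simp: good_sets_def)

lemma card_good_sets_le: "finite V \<Longrightarrow> card (good_sets V E k l) \<le> card V choose k"
  using n_subsets[of V k] card_mono[of "{S. S \<subseteq> V \<and> card S = k}" "good_sets V E k l"]
  by (auto simp: good_sets_def)

lemma finite_edge_probs: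
  assumes "k \<le> n"
  shows "finite (edge_probs P n k l)"
proof (rule finite_subset)
  show "edge_probs P n k l \<subseteq> (\<lambda>m. real m / real (n choose k)) ` {..n choose k}"
  proof
    fix x assume "x \<in> edge_probs P n k l"
    then obtain V :: "nat set" and E where *: "x = edge_prob V E k l" "finite V" "card V = n"
      unfolding edge_probs_def hypergraph_def by blast
    have "x = real (card (good_sets V E k l)) / real (n choose k)"
      using edge_prob_eq[of V k E l] * assms by simp
    moreover have "card (good_sets V E k l) \<in> {..n choose k}"
      using card_good_sets_le[OF *(2), of E k l] *(3) by simp
    ultimately show "x \<in> (\<lambda>m. real m / real (n choose k)) ` {..n choose k}"
      by blast
  qed
qed simp

lemma edge_probs_nonempty: "edge_probs P n k l \<noteq> {}"
proof -
  have "edge_prob {..<n} {} k l \<in> edge_probs P n k l"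
    unfolding edge_probs_def mem_Collect_eq
    by (intro exI[of _ "{..<n}"] exI[of _ "{}"]) (simp add: hypergraph_def)
  then show ?thesis by blast
qed

lemma good_sets_delete:
  "good_sets (V - {v}) {e \<in> E. e \<subseteq> V - {v}} k l = {S \<in> good_sets V E k l. v \<notin> S}"
proof -
  have "{e \<in> {e \<in> E. e \<subseteq> V - {v}}. e \<subseteq> S} = {e \<in> E. e \<subseteq> S}" if "S \<subseteq> V - {v}" for S
    using that by auto
  then have "S \<in> good_sets (V - {v}) {e \<in> E. e \<subseteq> V - {v}} k l \<longleftrightarrow>
      S \<in> {S \<in> good_sets V E k l. v \<notin> S}" for S
    unfolding good_sets_def mem_Collect_eq by (cases "S \<subseteq> V - {v}") (simp_all, blast+)
  then show ?thesis by blast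
qed

lemma sum_good_sets_delete:
  assumes "finite V"
  shows "(\<Sum>v\<in>V. card (good_sets (V - {v}) {e \<in> E. e \<subseteq> V - {v}} k l))
           = (card V - k) * card (good_sets V E k l)"
proof -
  let ?G = "good_sets V E k l"
  have fG: "finite ?G" by (rule finite_good_sets[OF assms])
  have "(\<Sum>v\<in>V. card {S \<in> ?G. v \<notin> S}) = (\<Sum>v\<in>V. \<Sum>S\<in>?G. if v \<notin> S then 1 else 0)"
    using fG by (intro sum.cong refl) (simp add: sum.If_cases Int_def)
  also have "\<dots> = (\<Sum>S\<in>?G. \<Sum>v\<in>V. if v \<notin> S then 1 else 0)"
    by (rule sum.swap)
  also have "\<dots> = (\<Sum>S\<in>?G. card V - k)"
  proof (rule sum.cong[OF refl])
    fix S assume "S \<in> ?G"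
    then have S: "S \<subseteq> V" "card S = k" by (auto simp: good_sets_def)
    have "(\<Sum>v\<in>V. if v \<notin> S then 1 else 0) = card (V - S)"
      using assms by (simp add: sum.If_cases Int_def set_diff_eq)
    also have "\<dots> = card V - k"
      using S assms by (simp add: card_Diff_subset finite_subset)
    finally show "(\<Sum>v\<in>V. if v \<notin> S then 1 else 0) = card V - k" .
  qed
  finally show ?thesis
    by (simp add: good_sets_delete mult.commute)
qed

lemma Max_edge_probs_Suc:
  assumes "k \<le> n"
  shows "Max (edge_probs P (Suc n) k l) \<le> Max (edge_probs P n k l)"
proof (rule Max.boundedI)
  let ?M = "Max (edge_probs P n k l)"
  show "finite (edge_probs P (Suc n) k l)"
    using assms by (simp add: finite_edge_probs)
  show "edge_probs P (Suc n) k l \<noteq> {}" by (rule edge_probs_nonempty)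
  fix x assume "x \<in> edge_probs P (Suc n) k l"
  then obtain V :: "nat set" and E where x: "x = edge_prob V E k l"
    and V: "finite V" "card V = Suc n" and E: "\<forall>e\<in>E. e \<subseteq> V \<and> e \<noteq> {}" "\<forall>e\<in>E. P e"
    unfolding edge_probs_def hypergraph_def by auto
  let ?E = "\<lambda>v. {e \<in> E. e \<subseteq> V - {v}}"
  have pos: "0 < real (n choose k)" "0 < real (Suc n choose k)"
    using assms by simp_all
  have le: "real (card (good_sets (V - {v}) (?E v) k l)) \<le> ?M * real (n choose k)"
    if v: "v \<in> V" for v
  proof -
    have c: "card (V - {v}) = n" "finite (V - {v})" using v V by simp_all
    have "hypergraph (V - {v}) (?E v)"
      using E V(1) by (auto simp: hypergraph_def)
    then have "edge_prob (V - {v}) (?E v) k l \<in> edge_probs P n k l"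
      unfolding edge_probs_def using c E(2) by blast
    then have "edge_prob (V - {v}) (?E v) k l \<le> ?M"
      using finite_edge_probs[OF assms] by (rule Max_ge[rotated])
    moreover have "edge_prob (V - {v}) (?E v) k l
        = real (card (good_sets (V - {v}) (?E v) k l)) / real (n choose k)"
      using edge_prob_eq[of "V - {v}" k "?E v" l] c assms by simp
    ultimately show ?thesis
      using pos by (simp add: divide_le_eq)
  qed
  have "real ((Suc n - k) * card (good_sets V E k l))
      = (\<Sum>v\<in>V. real (card (good_sets (V - {v}) (?E v) k l)))"
    using sum_good_sets_delete[OF V(1), of E k l] V(2) by (simp only: of_nat_sum[symmetric])
  also have "\<dots> \<le> (\<Sum>v\<in>V. ?M * real (n choose k))"
    by (rule sum_mono) (rule le)
  also have "\<dots> = ?M * real (Suc n * (n choose k))"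
    using V(2) by (simp add: algebra_simps)
  also have "Suc n * (n choose k) = (Suc n - k) * (Suc n choose k)"
    using binomial_absorb_comp[of "Suc n" k] by simp
  finally have "real (Suc n - k) * real (card (good_sets V E k l))
      \<le> real (Suc n - k) * (?M * real (Suc n choose k))"
    by (simp only: of_nat_mult mult_ac)
  then have "real (card (good_sets V E k l)) \<le> ?M * real (Suc n choose k)"
    using assms by (subst (asm) mult_le_cancel_left_pos) auto
  then show "x \<le> ?M"
    using edge_prob_eq[of V k E l] V assms pos by (simp add: x divide_le_eq)
qed

lemma convergent_Max_edge_probs: "convergent (\<lambda>n. Max (edge_probs P n k l))"
proof -
  let ?X = "\<lambda>n. Max (edge_probs P (n + k) k l)"
  have dec: "decseq ?X"
    by (rule decseq_SucI) (simp add: Max_edge_probs_Suc)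
  have nn: "0 \<le> ?X n" for n
  proof -
    have "?X n \<in> edge_probs P (n + k) k l"
      by (rule Max_in) (simp_all add: finite_edge_probs edge_probs_nonempty)
    then show ?thesis by (auto simp: edge_probs_def edge_prob_def)
  qed
  obtain L where "?X \<longlonglongrightarrow> L"
    using decseq_convergent[OF dec, of 0] nn by blast
  then show ?thesis
    using LIMSEQ_offset[of "\<lambda>n. Max (edge_probs P n k l)" k L] by (auto simp: convergent_def)
qed

lemma convergent_I_unif: "convergent (\<lambda>n. I_unif r n k l)"
  using convergent_Max_edge_probs[of "\<lambda>e. card e = r"]
  by (simp add: I_unif_def edge_probs_def)

lemma convergent_I_atmost: "convergent (\<lambda>n. I_atmost r n k l)"
  using convergent_Max_edge_probs[of "\<lambda>e. card e \<le> r"]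
  by (simp add: I_atmost_def edge_probs_def)

end

theory Submission
  imports Defs
begin

text \<open>
  Group the vertex sets \<open>A\<close> with exactly \<open>l\<close> edges by the set \<open>L\<close> of these edges, and let
  \<open>m = card (\<Union>L)\<close>, so that \<open>l\<^sup>1\<^sup>/\<^sup>r r / 3 \<le> m \<le> r l \<le> (1 - \<epsilon>) k\<close>. Let \<open>P(K)\<close> be the
  probability that a random \<open>K\<close>-set has edge set \<open>L\<close>.

  The probability that a random \<open>K\<close>-set has at least \<open>l\<close> edges increases with \<open>K\<close>, and the
  step from \<open>K - 1\<close> to \<open>K\<close> is at least the sum over \<open>L\<close> of \<open>(m / K) P(K)\<close>: deleting a random
  vertex from a \<open>K\<close>-set with edge set \<open>L\<close> destroys an edge with probability \<open>m / K\<close>. Hence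
  the sum of \<open>(m / K) P(K)\<close> over all \<open>K\<close> and \<open>L\<close> is at most \<open>1\<close>.

  On the other hand, \<open>P(K + 1) / P(K) = (1 - q(K)) / (1 - m / (K + 1))\<close>, where \<open>q(K)\<close> is the
  probability that a random further vertex creates a new edge. As edges have at most \<open>r\<close>
  vertices, a double count in the style of Moon and Moser shows that \<open>q\<close> grows at most like
  \<open>(K - m)\<^sup>r\<^sup>-\<^sup>1\<close>. So \<open>P(K)\<close> stays above \<open>P(k) / 2\<close> on a window of length about
  \<open>(k - m) / sqrt (8 r m)\<close>, to the right of \<open>k\<close> if \<open>q(k) \<le> m / k\<close> and to the left otherwise.
  Combining the two facts, the sum of \<open>P(k)\<close> over \<open>L\<close> is \<open>O(k / (k - m) sqrt (r / m))\<close>.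
\<close>

section \<open>Moon--Moser inequality for locally determined families\<close>

text \<open>In the application \<open>F\<close> consists of the vertex sets whose edge set is a
  fixed \<open>L\<close>, and \<open>B\<close> is the union of \<open>L\<close>. The last assumption
  says that a vertex \<open>v\<close> is excluded by fewer than \<open>r\<close> vertices of
  \<open>A\<close>, namely by the rest of a new edge through \<open>v\<close>.\<close>

locale local_interval_family =
  fixes V B :: "'a set" and F :: "'a set set" and r :: nat
  assumes finite_V: "finite V"
    and bounds: "A \<in> F \<Longrightarrow> B \<subseteq> A \<and> A \<subseteq> V"
    and down: "A \<in> F \<Longrightarrow> B \<subseteq> A' \<Longrightarrow> A' \<subseteq> A \<Longrightarrow> A' \<in> F"
    and local: "A \<in> F \<Longrightarrow> v \<in> V - A \<Longrightarrow> insert v A \<notin> F \<Longrightarrow>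
      \<exists>T\<subseteq>A. card T < r \<and> (\<forall>A'. T \<subseteq> A' \<longrightarrow> v \<in> A' \<longrightarrow> A' \<notin> F)"
begin

section \<open>Double counts between consecutive levels\<close>

definition level :: "nat \<Rightarrow> 'a set set" where
  "level K = {A \<in> F. card A = K}"

definition good_ext :: "'a set \<Rightarrow> 'a set" where
  "good_ext A = {v \<in> V - A. insert v A \<in> F}"

definition bad_ext :: "'a set \<Rightarrow> 'a set" where
  "bad_ext A = {v \<in> V - A. insert v A \<notin> F}"

definition bad_pairs :: "nat \<Rightarrow> nat" where
  "bad_pairs K = (\<Sum>A\<in>level K. card (bad_ext A))"

lemma finite_F: "finite F"
  by (rule finite_subset[of _ "Pow V"]) (use bounds finite_V in auto)

lemma finite_level: "finite (level K)"
  using finite_F by (simp add: level_def)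

lemma finite_ext: "finite (good_ext A)" "finite (bad_ext A)"
  using finite_V by (simp_all add: good_ext_def bad_ext_def)

lemma finite_member: "A \<in> F \<Longrightarrow> finite A"
  by (rule finite_subset[of _ V]) (simp_all add: bounds finite_V)

lemma finite_B: "A \<in> F \<Longrightarrow> finite B"
  by (rule finite_subset[of _ A]) (simp_all add: bounds finite_member)

lemma card_ext:
  assumes "A \<in> level K"
  shows "card (good_ext A) + card (bad_ext A) = card V - K"
proof -
  have A: "A \<in> F" "card A = K" using assms by (auto simp: level_def)
  have "card (good_ext A) + card (bad_ext A) = card (good_ext A \<union> bad_ext A)"
    by (subst card_Un_disjoint) (simp_all add: finite_ext, auto simp: good_ext_def bad_ext_def)
  also have "good_ext A \<union> bad_ext A = V - A"
    by (auto simp: good_ext_def bad_ext_def)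
  finally show ?thesis
    using A bounds[OF A(1)] by (simp add: card_Diff_subset finite_member)
qed

text \<open>Adding \<open>v\<close> is undone by deleting \<open>v\<close>: as \<open>F\<close> is
  closed under shrinking down to \<open>B\<close>, each set of level \<open>Suc K\<close> arises
  exactly once for each of its elements outside \<open>B\<close>.\<close>

lemma sum_good_ext:
  "(\<Sum>A\<in>level K. card (good_ext A)) = (Suc K - card B) * card (level (Suc K))"
proof -
  have "(\<Sum>A\<in>level K. card (good_ext A)) = card (SIGMA A:level K. good_ext A)"
    by (rule card_SigmaI[symmetric]) (auto simp: finite_level finite_ext)
  also have "\<dots> = card (SIGMA A:level (Suc K). A - B)"
  proof (rule bij_betw_same_card, rule bij_betwI')
    let ?f = "\<lambda>(A, v). (insert v A, v)"
    fix x y assume x: "x \<in> (SIGMA A:level K. good_ext A)" and y: "y \<in> (SIGMA A:level K. good_ext A)"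
    obtain A v A' v' where xy: "x = (A, v)" "y = (A', v')" "v \<notin> A" "v' \<notin> A'"
      using x y by (auto simp: good_ext_def)
    then show "(?f x = ?f y) = (x = y)"
      using insert_ident[of v A A'] by auto
  next
    let ?f = "\<lambda>(A, v). (insert v A, v)"
    fix x assume x: "x \<in> (SIGMA A:level K. good_ext A)"
    then obtain A v where "x = (A, v)" "A \<in> F" "card A = K" "v \<in> V - A" "insert v A \<in> F"
      by (auto simp: level_def good_ext_def)
    then show "?f x \<in> (SIGMA A:level (Suc K). A - B)"
      using bounds[of A] finite_member[of A] by (auto simp: level_def)
  next
    let ?f = "\<lambda>(A, v). (insert v A, v)"
    fix y assume "y \<in> (SIGMA A:level (Suc K). A - B)"
    then obtain A v where A: "y = (A, v)" "A \<in> F" "card A = Suc K" "v \<in> A" "v \<notin> B"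
      by (auto simp: level_def)
    have "A - {v} \<in> F"
      using down[OF A(2), of "A - {v}"] bounds[OF A(2)] A(5) by blast
    moreover have "card (A - {v}) = K" using A by simp
    moreover have "insert v (A - {v}) = A" using A by blast
    ultimately have "(A - {v}, v) \<in> (SIGMA A:level K. good_ext A)"
      using A bounds[OF A(2)] by (auto simp: level_def good_ext_def)
    moreover have "y = ?f (A - {v}, v)" using A by auto
    ultimately show "\<exists>x\<in>(SIGMA A:level K. good_ext A). y = ?f x" by blast
  qed
  also have "\<dots> = (\<Sum>A\<in>level (Suc K). card (A - B))"
    by (rule card_SigmaI) (auto simp: finite_level, auto simp: finite_member level_def)
  also have "\<dots> = (\<Sum>A\<in>level (Suc K). Suc K - card B)"
    by (rule sum.cong[OF refl]) (use bounds finite_B in \<open>auto simp: level_def card_Diff_subset\<close>)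
  finally show ?thesis by simp
qed

lemma bad_pairs_eq:
  "bad_pairs K + (Suc K - card B) * card (level (Suc K)) = (card V - K) * card (level K)"
proof -
  have "bad_pairs K + (Suc K - card B) * card (level (Suc K))
      = (\<Sum>A\<in>level K. card (good_ext A) + card (bad_ext A))"
    by (simp add: bad_pairs_def sum_good_ext[symmetric] sum.distrib)
  also have "\<dots> = (\<Sum>A\<in>level K. card V - K)"
    by (rule sum.cong[OF refl]) (rule card_ext)
  finally show ?thesis by simp
qed

text \<open>Counts triples \<open>(A, v, i)\<close> where \<open>v\<close> is bad for
  \<open>A\<close> and still bad for \<open>A - {i}\<close>. For given \<open>A\<close> and
  \<open>v\<close>, every \<open>i\<close> outside \<open>B\<close> and outside the witness
  \<open>T\<close> qualifies, which gives the left side. Deleting \<open>i\<close> gives a set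
  \<open>C\<close> with \<open>i\<close> good and \<open>v\<close> bad for it, which gives the right
  side.\<close>

lemma bad_triples:
  "(Suc K - card B - (r - 1)) * bad_pairs (Suc K)
     \<le> (\<Sum>C\<in>level K. card (good_ext C) * card (bad_ext C))"
proof -
  let ?R = "\<lambda>A v. {i \<in> A - B. insert v (A - {i}) \<notin> F}"
  let ?S = "SIGMA A:level (Suc K). SIGMA v:bad_ext A. ?R A v"
  let ?T = "SIGMA C:level K. good_ext C \<times> bad_ext C"
  have R: "Suc K - card B - (r - 1) \<le> card (?R A v)"
    if A: "A \<in> level (Suc K)" and v: "v \<in> bad_ext A" for A v
  proof -
    have AF: "A \<in> F" "card A = Suc K" using A by (auto simp: level_def)
    obtain T where T: "T \<subseteq> A" "card T < r" "\<forall>A'. T \<subseteq> A' \<longrightarrow> v \<in> A' \<longrightarrow> A' \<notin> F"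
      using local[OF AF(1), of v] v by (auto simp: bad_ext_def)
    have "Suc K - card B - (r - 1) \<le> card (A - B) - card T"
      using AF T(2) bounds[OF AF(1)] finite_B[OF AF(1)] by (simp add: card_Diff_subset)
    also have "\<dots> \<le> card (A - B - T)"
      by (rule diff_card_le_card_Diff) (use T(1) finite_member[OF AF(1)] finite_subset in blast)
    also have "\<dots> \<le> card (?R A v)"
    proof (rule card_mono)
      show "finite (?R A v)" using finite_member[OF AF(1)] by simp
      have "insert v (A - {i}) \<notin> F" if "i \<notin> T" for i
        using T(1) that by (intro T(3)[rule_format]) auto
      then show "A - B - T \<subseteq> ?R A v" by blast
    qed
    finally show ?thesis .
  qed
  have fR: "finite (?R A v)" if "A \<in> level (Suc K)" for A v
    using that finite_member by (auto simp: level_def)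
  have "(Suc K - card B - (r - 1)) * bad_pairs (Suc K)
      = (\<Sum>A\<in>level (Suc K). \<Sum>v\<in>bad_ext A. Suc K - card B - (r - 1))"
    by (simp add: bad_pairs_def sum_distrib_left mult.commute)
  also have "\<dots> \<le> (\<Sum>A\<in>level (Suc K). \<Sum>v\<in>bad_ext A. card (?R A v))"
    by (intro sum_mono R)
  also have "\<dots> = (\<Sum>A\<in>level (Suc K). card (SIGMA v:bad_ext A. ?R A v))"
    by (rule sum.cong[OF refl], rule card_SigmaI[symmetric]) (use fR in \<open>simp_all add: finite_ext\<close>)
  also have "\<dots> = card ?S"
    by (rule card_SigmaI[symmetric])
      (use fR in \<open>simp_all add: finite_level finite_ext finite_SigmaI\<close>)
  also have "\<dots> \<le> card ?T"
  proof (rule card_inj_on_le)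
    let ?f = "\<lambda>(A, v, i). (A - {i}, i, v)"
    show "inj_on ?f ?S"
    proof (rule inj_onI)
      fix x y assume xy: "x \<in> ?S" "y \<in> ?S" "?f x = ?f y"
      obtain A v i A' v' i' where eq: "x = (A, v, i)" "y = (A', v', i')"
        by (metis prod_cases3)
      have "i \<in> A" "i' \<in> A'" "i = i'" "v = v'" "A - {i} = A' - {i'}"
        using xy unfolding eq by auto
      then have "A = A'" by (metis insert_Diff)
      then show "x = y" using \<open>i = i'\<close> \<open>v = v'\<close> eq by simp
    qed
    show "?f ` ?S \<subseteq> ?T"
    proof
      fix y assume "y \<in> ?f ` ?S"
      then obtain A v i where y: "y = (A - {i}, i, v)" and A: "A \<in> F" "card A = Suc K"
        and v: "v \<in> V" "v \<notin> A" and i: "i \<in> A" "i \<notin> B" "insert v (A - {i}) \<notin> F"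
        by (auto simp: level_def bad_ext_def)
      have "A - {i} \<in> F"
        using down[OF A(1), of "A - {i}"] bounds[OF A(1)] i(2) by blast
      moreover have "card (A - {i}) = K" using A i by simp
      moreover have "insert i (A - {i}) = A" using i by blast
      ultimately show "y \<in> ?T"
        using y A v i bounds[OF A(1)] by (auto simp: level_def good_ext_def bad_ext_def)
    qed
    show "finite ?T" by (auto simp: finite_level finite_ext)
  qed
  also have "\<dots> = (\<Sum>C\<in>level K. card (good_ext C \<times> bad_ext C))"
    by (rule card_SigmaI) (auto simp: finite_level finite_ext)
  finally show ?thesis by (simp add: card_cartesian_product)
qed

text \<open>Every \<open>C\<close> in level \<open>K\<close> has \<open>card V - K\<close>
  extensions, so the right side of \<open>bad_triples\<close> is a linear term minus a sum of
  squares, and Cauchy-Schwarz bounds the squares by the mean. The form without division also covers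
  an empty level.\<close>

lemma bad_pairs_step:
  assumes "card B \<le> K" "K \<le> card V" "r \<ge> 1"
  shows "(real (Suc K) - real (card B) - (real r - 1)) * real (bad_pairs (Suc K)) * real (card (level K))
    \<le> (real (Suc K) - real (card B)) * real (card (level (Suc K))) * real (bad_pairs K)"
proof -
  define S where "S = (real (Suc K) - real (card B)) * real (card (level (Suc K)))"
  let ?a = "\<lambda>C. real (card (good_ext C))"
  let ?g = "real (card (level K))"
  have S: "(\<Sum>C\<in>level K. ?a C) = S"
    using arg_cong[OF sum_good_ext[of K], of real] assms by (simp add: S_def of_nat_diff)
  have D: "real (bad_pairs K) = (real (card V) - real K) * ?g - S"
    using arg_cong[OF bad_pairs_eq[of K], of real] assms by (simp add: S_def of_nat_diff)
  \<comment> \<open>Natural subtraction truncates at 0, so it can only exceed the real difference,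
    which is the direction needed.\<close>
  have "real (Suc K) - real (card B) - (real r - 1) \<le> real (Suc K - card B - (r - 1))"
    using assms(3) by linarith
  then have "(real (Suc K) - real (card B) - (real r - 1)) * real (bad_pairs (Suc K))
      \<le> real ((Suc K - card B - (r - 1)) * bad_pairs (Suc K))"
    unfolding of_nat_mult by (rule mult_right_mono) simp
  also have "\<dots> \<le> real (\<Sum>C\<in>level K. card (good_ext C) * card (bad_ext C))"
    using bad_triples by (rule of_nat_mono)
  also have "\<dots> = (\<Sum>C\<in>level K. ?a C * (real (card V) - real K - ?a C))"
    unfolding of_nat_sum of_nat_mult
  proof (rule sum.cong[OF refl])
    fix C assume "C \<in> level K"
    from arg_cong[OF card_ext[OF this], of real] assms
    have "real (card (bad_ext C)) = real (card V) - real K - ?a C" by (simp add: of_nat_diff)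
    then show "?a C * real (card (bad_ext C)) = ?a C * (real (card V) - real K - ?a C)" by simp
  qed
  also have "\<dots> = (real (card V) - real K) * S - (\<Sum>C\<in>level K. (?a C)\<^sup>2)"
    by (simp add: S[symmetric] sum_subtractf sum_distrib_left sum.distrib algebra_simps power2_eq_square)
  finally have 1: "(real (Suc K) - real (card B) - (real r - 1)) * real (bad_pairs (Suc K)) * ?g
      \<le> ((real (card V) - real K) * S - (\<Sum>C\<in>level K. (?a C)\<^sup>2)) * ?g"
    by (rule mult_right_mono) simp
  have "S\<^sup>2 \<le> ?g * (\<Sum>C\<in>level K. (?a C)\<^sup>2)"
    using Cauchy_Schwarz_ineq_sum[of "\<lambda>_. 1" ?a "level K"] by (simp add: S)
  then have "((real (card V) - real K) * S - (\<Sum>C\<in>level K. (?a C)\<^sup>2)) * ?g \<le> S * real (bad_pairs K)"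
    by (simp add: D algebra_simps power2_eq_square)
  with 1 show ?thesis by (simp add: S_def)
qed

lemma level_nonempty_pred:
  assumes "level (Suc K) \<noteq> {}" "card B \<le> K"
  shows "level K \<noteq> {}"
proof -
  obtain A where A: "A \<in> F" "card A = Suc K" using assms by (auto simp: level_def)
  have "card (A - B) > 0"
    using A assms(2) bounds[OF A(1)] finite_B[OF A(1)] by (simp add: card_Diff_subset)
  then obtain i where i: "i \<in> A" "i \<notin> B" by (auto simp: card_gt_0_iff)
  have "A - {i} \<in> F"
    using down[OF A(1), of "A - {i}"] bounds[OF A(1)] i by blast
  then show ?thesis using A i by (auto simp: level_def)
qed

end

section \<open>Window estimate\<close>

text \<open>\<open>P K\<close> stands for the probability that a random \<open>K\<close>-set lies in
  the class, \<open>d K\<close> for the mean number of bad extensions over level \<open>K\<close>,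
  and \<open>m\<close> for the size of the union of the edges. Thus \<open>d K / (n - K)\<close> is
  the probability that a random further vertex creates an edge.\<close>

locale smooth_profile =
  fixes P d :: "nat \<Rightarrow> real" and k m n r :: nat
  assumes P_nonneg: "P K \<ge> 0"
    and d_nonneg: "d K \<ge> 0"
    and P_pred: "m \<le> K \<Longrightarrow> P (Suc K) > 0 \<Longrightarrow> P K > 0"
    and P_step: "m \<le> K \<Longrightarrow> K < n \<Longrightarrow>
      P (Suc K) * (1 - real m / real (Suc K)) = P K * (1 - d K / (real n - real K))"
    and d_step: "m \<le> K \<Longrightarrow> K < n \<Longrightarrow> P (Suc K) > 0 \<Longrightarrow>
      d (Suc K) * (1 - (real r - 1) / (real (Suc K) - real m)) \<le> d K"
    and r_pos: "r \<ge> 1" and m_large: "m \<ge> 1000 * r" and m_less: "m < k" and n_large: "n \<ge> 20 * k"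
begin

lemma P_pos_below:
  assumes "P hi > 0" "lo \<le> hi" "m \<le> lo"
  shows "P lo > 0"
  using assms(2,1)
proof (induction rule: dec_induct)
  case (step j)
  then show ?case using P_pred[of j] assms(3) by auto
qed

text \<open>Iterates \<open>d_step\<close>, bounding each factor by the worst one, at
  \<open>lo\<close>, and linearising the product by
  \<open>(1 - a) * (1 - b) \<ge> 1 - (a + b)\<close>.\<close>

lemma d_decay:
  assumes "m < lo" "lo \<le> hi" "hi \<le> n" "P hi > 0"
  shows "d hi * (1 - (real r - 1) * (real hi - real lo) / (real lo - real m)) \<le> d lo"
  using assms(2-4)
proof (induction rule: dec_induct)
  case base
  then show ?case by simp
next
  case (step j)
  define a where "a = (real r - 1) / (real lo - real m)"
  define b where "b = (real r - 1) * (real j - real lo) / (real lo - real m)"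
  have ab: "0 \<le> a" "0 \<le> b" using r_pos assms(1) step by (auto simp: a_def b_def)
  have sum: "(real r - 1) * (real (Suc j) - real lo) / (real lo - real m) = a + b"
    by (simp add: a_def b_def add_divide_distrib[symmetric] algebra_simps)
  have "P j > 0" using P_pos_below[of "Suc j" j] step assms(1) by auto
  then have IH: "d j * (1 - b) \<le> d lo" using step by (simp add: b_def)
  have "(real r - 1) / (real (Suc j) - real m) \<le> a"
    unfolding a_def by (rule divide_left_mono) (use r_pos step assms(1) in auto)
  then have "d (Suc j) * (1 - a) \<le> d (Suc j) * (1 - (real r - 1) / (real (Suc j) - real m))"
    by (intro mult_left_mono d_nonneg) simp
  also have "\<dots> \<le> d j" by (rule d_step) (use step assms(1) in auto)
  finally have st: "d (Suc j) * (1 - a) \<le> d j" .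
  show ?case unfolding sum
  proof (cases "b \<le> 1")
    case True
    have "d (Suc j) * (1 - (a + b)) \<le> d (Suc j) * ((1 - a) * (1 - b))"
      using ab by (intro mult_left_mono d_nonneg) (simp add: algebra_simps)
    also have "\<dots> = (d (Suc j) * (1 - a)) * (1 - b)" by simp
    also have "\<dots> \<le> d j * (1 - b)" using st True by (intro mult_right_mono) auto
    finally show "d (Suc j) * (1 - (a + b)) \<le> d lo" using IH by simp
  next
    \<comment> \<open>For \<open>b > 1\<close> the induction hypothesis says nothing, but the left
      side is then at most 0.\<close>
    case False
    then have "d (Suc j) * (1 - (a + b)) \<le> 0"
      using ab d_nonneg by (simp add: mult_nonneg_nonpos)
    then show "d (Suc j) * (1 - (a + b)) \<le> d lo" using d_nonneg[of lo] by linarith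
  qed
qed

text \<open>\<open>w\<close> is the window length, \<open>z\<close> its ratio to
  \<open>s = k - m\<close>, and \<eta> the relative loss of \<open>P\<close> allowed per step. The
  last assumption amounts to \<open>w * \<eta> \<le> 1/2\<close>, so that \<open>P\<close> at most
  halves over the window.\<close>

context
  fixes w :: nat and s z \<eta> :: real
  assumes s: "s = real k - real m" and z: "z = real w / s"
    and \<eta>: "\<eta> = 4 * real r * real m * real w / s\<^sup>2"
    and w: "8 * real r * real m * (real w)\<^sup>2 \<le> s\<^sup>2"
begin

lemma w_small: "80 * real r * real w \<le> s"
proof (rule power2_le_imp_le)
  \<comment> \<open>\<open>80 * 80 = 6400\<close> is below \<open>8 * 1000\<close>, where 1000 comes
    from \<open>m_large\<close>.\<close>
  have "(80 * real r * real w)\<^sup>2 \<le> 8 * real r * (1000 * real r) * (real w)\<^sup>2"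
    by (simp add: power2_eq_square)
  also have "\<dots> \<le> 8 * real r * real m * (real w)\<^sup>2"
    using of_nat_mono[OF m_large, where ?'a = real] by (intro mult_right_mono mult_left_mono) simp_all
  finally show "(80 * real r * real w)\<^sup>2 \<le> s\<^sup>2" using w by simp
qed (use m_less s in simp)

lemma z_bounds: "real r * z \<le> 1/80" "0 \<le> z" "z \<le> real r * z" "w = z * s"
proof -
  have "s > 0" using s m_less by simp
  then show "real r * z \<le> 1/80" and z0: "0 \<le> z" and "w = z * s"
    using w_small unfolding z by (simp_all add: field_simps)
  show "z \<le> real r * z" using mult_right_mono[OF _ z0, of 1 "real r"] r_pos by simp
qed

lemma eta_bounds: "0 \<le> \<eta>" "real w * \<eta> \<le> 1/2" "\<eta> * (s / k) = real m / real k * (4 * real r * z)"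
proof -
  have "s > 0" using s m_less by simp
  then show "0 \<le> \<eta>" "real w * \<eta> \<le> 1/2" "\<eta> * (s / k) = real m / real k * (4 * real r * z)"
    using w m_less by (simp_all add: \<eta> z field_simps power2_eq_square)
qed

text \<open>The ratio of the two values is \<open>(1 - q) / (1 - y)\<close>. Inside the window
  \<open>q\<close> stays below \<open>m / k * (1 + 2 * r * z)\<close> by \<open>d_decay\<close>, and
  \<open>y\<close> stays above \<open>m / k * (1 - z)\<close>. Hence \<open>q - y\<close> is at most
  \<open>\<eta> * (1 - y)\<close>.\<close>

lemma P_up_step:
  assumes q: "d k / (real n - real k) \<le> real m / real k" and i: "i < w" and pos: "P (k + i) > 0"
  shows "P (Suc (k + i)) \<ge> P (k + i) * (1 - \<eta>)"
proof -
  let ?K = "k + i"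
  define q where "q = d ?K / (real n - real ?K)"
  define y where "y = real m / real (Suc ?K)"
  note rz = z_bounds
  have k0: "real k > 0" "s > 0" "s \<le> real k" "real k - real m = s" using m_less s by auto
  have wk: "80 * real w \<le> real k"
    using w_small mult_right_mono[of 1 "real r" "real w"] r_pos k0 by simp
  have nK: "real n - real ?K \<ge> 18 * real k" "real n - real k > 0"
    using n_large wk i k0 by linarith+
  have "d ?K * (1 - (real r - 1) * z) \<le> d ?K * (1 - (real r - 1) * (real ?K - real k) / s)"
  proof (intro mult_left_mono d_nonneg)
    have "(real r - 1) * real i / s \<le> (real r - 1) * real w / s"
      by (intro divide_right_mono mult_left_mono) (use r_pos i k0 in auto)
    then show "1 - (real r - 1) * z \<le> 1 - (real r - 1) * (real ?K - real k) / s" by (simp add: z)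
  qed
  also have "\<dots> \<le> d k"
    unfolding s by (rule d_decay) (use m_less n_large wk i pos k0 nK in auto)
  also have "\<dots> \<le> real m / real k * (real n - real k)"
    using q nK by (simp add: field_simps)
  \<comment> \<open>Since \<open>n \<ge> 20 * k\<close>, the at most \<open>w\<close> steps change
    \<open>n - k\<close> only by the relative amount \<open>z / 2\<close>.\<close>
  also have "\<dots> \<le> real m / real k * ((1 + z / 2) * (real n - real ?K))"
  proof (rule mult_left_mono)
    have "z / 2 * (real n - real ?K) \<ge> z / 2 * (18 * s)"
      using nK k0 rz(2) by (intro mult_left_mono) auto
    then have "z / 2 * (real n - real ?K) \<ge> 9 * real w" using rz(4) by (simp add: mult_ac)
    then have "z / 2 * (real n - real ?K) \<ge> real i" using i by linarith
    then show "real n - real k \<le> (1 + z / 2) * (real n - real ?K)"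
      by (simp add: algebra_simps)
  qed simp
  \<comment> \<open>Brings in the factor \<open>1 - (r - 1) * z\<close> of the left side, to be
    cancelled below. The quadratic term of the product is harmless because
    \<open>r * z \<le> 1/80\<close>.\<close>
  also have "\<dots> \<le> real m / real k * ((1 + 2 * real r * z) * (1 - (real r - 1) * z) * (real n - real ?K))"
  proof (intro mult_left_mono mult_right_mono)
    have "2 * (real r * z) * ((real r - 1) * z) \<le> 2 * (1/80) * ((real r - 1) * z)"
      using rz r_pos by (intro mult_right_mono) auto
    then show "1 + z / 2 \<le> (1 + 2 * real r * z) * (1 - (real r - 1) * z)"
      using rz by (simp add: algebra_simps)
  qed (use nK k0 in auto)
  finally have "d ?K * (1 - (real r - 1) * z)
      \<le> (real m / real k * (1 + 2 * real r * z) * (real n - real ?K)) * (1 - (real r - 1) * z)"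
    by (simp only: mult_ac)
  moreover have "1 - (real r - 1) * z > 0" using rz by (simp add: algebra_simps)
  ultimately have "d ?K \<le> real m / real k * (1 + 2 * real r * z) * (real n - real ?K)"
    by (simp only: mult_le_cancel_right_pos)
  then have q1: "q \<le> real m / real k * (1 + 2 * real r * z)"
    using nK k0 unfolding q_def by (subst pos_divide_le_eq) auto
  have y1: "y \<ge> real m / real k * (1 - z)"
  proof -
    have "(1 - z) * real (Suc ?K) \<le> (1 - z) * (real k + real w)"
      using rz i by (intro mult_left_mono) auto
    also have "\<dots> \<le> real k"
    proof -
      have "z * real k \<ge> z * s" using k0 rz by (intro mult_left_mono) auto
      moreover have "z * real w \<ge> 0" using rz by simp
      ultimately show ?thesis using rz(4) by (simp add: algebra_simps)
    qed
    finally have "real m * ((1 - z) * real (Suc ?K)) \<le> real m * real k"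
      by (intro mult_left_mono) auto
    then show ?thesis using k0 by (simp add: y_def field_simps)
  qed
  have y2: "1 - y \<ge> s / k"
  proof -
    have "y \<le> real m / real k" unfolding y_def using k0 by (intro divide_left_mono) auto
    moreover have "s / k = 1 - real m / real k" using k0(1) unfolding s by (simp add: diff_divide_distrib)
    ultimately show ?thesis by linarith
  qed
  have "q - y \<le> real m / real k * ((2 * real r + 1) * z)"
    using q1 y1 by (simp add: algebra_simps diff_divide_distrib add_divide_distrib)
  also have "\<dots> \<le> real m / real k * (4 * real r * z)"
    using rz r_pos by (intro mult_left_mono mult_right_mono) auto
  also have "\<dots> \<le> \<eta> * (1 - y)"
    unfolding eta_bounds(3)[symmetric] by (rule mult_left_mono[OF y2 eta_bounds(1)])
  finally have "(1 - \<eta>) * (1 - y) \<le> 1 - q" by (simp add: algebra_simps)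
  then have "P ?K * ((1 - \<eta>) * (1 - y)) \<le> P ?K * (1 - q)"
    by (intro mult_left_mono P_nonneg)
  also have "\<dots> = P (Suc ?K) * (1 - y)"
    using P_step[of ?K] m_less nK k0 by (simp add: q_def y_def)
  finally have "P ?K * (1 - \<eta>) * (1 - y) \<le> P (Suc ?K) * (1 - y)" by (simp add: mult_ac)
  moreover have "1 - y > 0" using y2 k0 by (smt (verit) divide_pos_pos)
  ultimately show ?thesis by (simp only: mult_le_cancel_right_pos)
qed

text \<open>Mirror image of \<open>P_up_step\<close>: the ratio is now
  \<open>(1 - y) / (1 - q)\<close>, so \<open>q\<close> must not be far below \<open>y\<close>. For
  this \<open>d_decay\<close> is read from \<open>K\<close> up to \<open>k\<close>, as a lower bound
  on \<open>d K\<close>.\<close>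

lemma P_down_step:
  assumes q: "d k / (real n - real k) \<ge> real m / real k" and i: "i < w" and pos: "P (k - i) > 0"
    and posk: "P k > 0"
  shows "P (k - Suc i) \<ge> P (k - i) * (1 - \<eta>)"
proof -
  \<comment> \<open>\<open>K\<close> is the lower end of the step, so that
    \<open>Suc K = k - i\<close> and \<open>P_step\<close> applies at \<open>K\<close>.\<close>
  define K where "K = k - Suc i"
  define q where "q = d K / (real n - real K)"
  define y where "y = real m / real (Suc K)"
  note rz = z_bounds
  have k0: "real k > 0" "s > 0" "s \<le> real k" "real k - real m = s" using m_less s by auto
  have "80 * real w \<le> s"
    using w_small mult_right_mono[of 1 "real r" "real w"] r_pos k0 by simp
  then have wk: "80 * real w \<le> s" "80 * real w \<le> real k" using k0 by auto
  have K: "Suc K = k - i" "m < K" "K < k" "real K = real k - (real i + 1)"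
  proof -
    have "Suc i < k - m" using i wk m_less k0 by linarith
    then show "Suc K = k - i" "m < K" "K < k" "real K = real k - (real i + 1)"
      unfolding K_def by auto
  qed
  have nK: "real n - real K \<ge> 18 * real k" "real n - real k > 0"
    using n_large k0 K by linarith+
  have z80: "z \<le> 1/80" using rz by linarith
  have Ks: "real K - real m \<ge> s * (1 - z)" using K i rz(4) k0 by (simp add: algebra_simps)
  \<comment> \<open>Going down shrinks the denominator from \<open>s\<close> to no less than
    \<open>s * (1 - z)\<close>; the constant 11/10 absorbs \<open>1 / (1 - z)\<close> for
    \<open>z \<le> 1/80\<close>.\<close>
  have a: "(real r - 1) * (real k - real K) / (real K - real m) \<le> (real r - 1) * (11/10 * z)"
  proof -
    have "(real r - 1) * ((real k - real K) / (real K - real m)) \<le> (real r - 1) * (real w / (s * (1 - z)))"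
      using Ks K i r_pos z80 k0 by (intro mult_left_mono frac_le) auto
    also have "real w / (s * (1 - z)) = z / (1 - z)" by (simp add: z)
    also have "z / (1 - z) \<le> 11/10 * z"
    proof -
      have "z * 1 \<le> z * (11/10 * (1 - z))" using z80 rz(2) by (intro mult_left_mono) auto
      then show ?thesis using z80 by (subst pos_divide_le_eq) (auto simp: mult_ac)
    qed
    finally show ?thesis using r_pos by (simp add: mult_left_mono)
  qed
  have rz1: "(real r - 1) * (11/10 * z) \<le> 1" using rz by (simp add: algebra_simps)
  have "real m / real k * (1 - z / 2) * (real n - real K) \<le> real m / real k * (real n - real k)"
  proof -
    have "z / 2 * (real n - real K) \<ge> z / 2 * (18 * s)"
      using nK k0 rz(2) by (intro mult_left_mono) auto
    then have "z / 2 * (real n - real K) \<ge> 9 * real w" using rz(4) by (simp add: mult_ac)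
    then have "z / 2 * (real n - real K) \<ge> real i + 1" using i by linarith
    then have "(1 - z / 2) * (real n - real K) \<le> real n - real k"
      using K(4) by (simp add: left_diff_distrib)
    then show ?thesis unfolding mult.assoc by (rule mult_left_mono) simp
  qed
  also have "\<dots> \<le> d k" using q nK by (simp add: field_simps)
  finally have dk: "real m / real k * (1 - z / 2) * (real n - real K) \<le> d k" .
  have "real m / real k * (1 - z / 2) * (real n - real K) * (1 - (real r - 1) * (11/10 * z))
      \<le> d k * (1 - (real r - 1) * (11/10 * z))"
    using dk rz1 by (intro mult_right_mono) auto
  also have "\<dots> \<le> d k * (1 - (real r - 1) * (real k - real K) / (real K - real m))"
    using a by (intro mult_left_mono d_nonneg) auto
  also have "\<dots> \<le> d K"
    by (rule d_decay) (use K n_large posk in auto)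
  finally have "real m / real k * (1 - z / 2) * (1 - (real r - 1) * (11/10 * z)) * (real n - real K) \<le> d K"
    by (simp only: mult_ac)
  then have "real m / real k * ((1 - z / 2) * (1 - (real r - 1) * (11/10 * z))) \<le> q"
    using nK k0 unfolding q_def by (subst pos_le_divide_eq) (auto simp: mult_ac)
  moreover have "real m / real k * (1 - 11/10 * real r * z)
      \<le> real m / real k * ((1 - z / 2) * (1 - (real r - 1) * (11/10 * z)))"
  proof (rule mult_left_mono)
    define a where "a = (real r - 1) * (11/10 * z)"
    have "0 \<le> z / 2 * a" using rz r_pos by (simp add: a_def)
    moreover have "(1 - z / 2) * (1 - a) = 1 - z / 2 - a + z / 2 * a"
      by (simp add: left_diff_distrib right_diff_distrib)
    moreover have "a = 11/10 * real r * z - 11/10 * z" by (simp add: a_def algebra_simps diff_divide_distrib)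
    ultimately show "1 - 11/10 * real r * z \<le> (1 - z / 2) * (1 - (real r - 1) * (11/10 * z))"
      unfolding a_def[symmetric] using rz(2) by linarith
  qed simp
  ultimately have q1: "real m / real k * (1 - 11/10 * real r * z) \<le> q" by linarith
  have y1: "y \<le> real m / real k * (1 + 11/10 * z)"
  proof -
    have "real k \<le> (1 + 11/10 * z) * (real k - real w)"
    proof -
      have "z * s * (79/80) \<le> z * (s - real w)"
        using rz(2) wk unfolding mult.assoc by (intro mult_left_mono) auto
      also have "\<dots> \<le> z * (real k - real w)" using rz(2) k0 by (intro mult_left_mono) auto
      finally show ?thesis using rz(4) by (simp add: algebra_simps)
    qed
    also have "\<dots> \<le> (1 + 11/10 * z) * real (Suc K)"
      using rz(2) K i by (intro mult_left_mono) auto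
    finally have "real m * real k \<le> real m * ((1 + 11/10 * z) * real (Suc K))"
      by (intro mult_left_mono) auto
    then show ?thesis using k0 by (simp add: y_def field_simps)
  qed
  have y2: "1 - y \<ge> s / k * (9/10)"
  proof -
    have "1 - y = (real (Suc K) - real m) / real (Suc K)"
      by (simp add: y_def field_simps)
    also have "\<dots> \<ge> (s * (9/10)) / real k"
      by (rule frac_le) (use K i wk k0 in auto)
    finally show ?thesis by simp
  qed
  have y3: "1 - y > 0" using y2 k0 by (smt (verit) divide_pos_pos mult_pos_pos)
  have eq: "P K * (1 - q) = P (Suc K) * (1 - y)"
    using P_step[of K] K n_large by (simp add: q_def y_def)
  have PK: "P (Suc K) > 0" "P K > 0" using pos P_pred[of K] K by auto
  have q0: "1 - q > 0"
    using eq PK y3 by (metis mult_pos_pos zero_less_mult_pos)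
  \<comment> \<open>If \<open>q \<ge> y\<close>, going down does not decrease \<open>P\<close> at
    all. Otherwise \<open>y - q\<close> is at most \<open>\<eta> * (1 - y)\<close>, hence at most
    \<open>\<eta> * (1 - q)\<close>.\<close>
  have "(1 - \<eta>) * (1 - q) \<le> 1 - y"
  proof (cases "q \<ge> y")
    case True
    have "(1 - \<eta>) * (1 - q) \<le> 1 * (1 - q)" using eta_bounds(1) q0 by (intro mult_right_mono) auto
    with True show ?thesis by simp
  next
    case False
    have "y - q \<le> real m / real k * (11/10 * (real r + 1) * z)"
      using q1 y1 by (simp add: algebra_simps diff_divide_distrib add_divide_distrib)
    also have "\<dots> \<le> real m / real k * (18/5 * real r * z)"
      using rz r_pos by (intro mult_left_mono mult_right_mono) auto
    also have "\<dots> = \<eta> * (s / k) * (9/10)" unfolding eta_bounds(3) by (simp add: mult_ac)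
    also have "\<dots> \<le> \<eta> * (1 - y)"
      unfolding mult.assoc by (rule mult_left_mono) (use y2 eta_bounds(1) in auto)
    also have "\<dots> \<le> \<eta> * (1 - q)" using False eta_bounds(1) by (intro mult_left_mono) auto
    finally show ?thesis by (simp add: algebra_simps)
  qed
  then have "P (Suc K) * ((1 - \<eta>) * (1 - q)) \<le> P (Suc K) * (1 - y)"
    using PK by (intro mult_left_mono) auto
  also have "\<dots> = P K * (1 - q)" using eq by simp
  finally have "P (Suc K) * (1 - \<eta>) * (1 - q) \<le> P K * (1 - q)" by (simp add: mult_ac)
  then have "P (Suc K) * (1 - \<eta>) \<le> P K" using q0 by (simp only: mult_le_cancel_right_pos)
  then show ?thesis using K by (simp add: K_def)
qed

text \<open>The losses add up to at most \<open>w * \<eta> \<le> 1/2\<close>. The bound by half of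
  \<open>Q 0\<close> supplies the positivity that each next step requires. A general sequence
  \<open>Q\<close> serves both directions, \<open>k + i\<close> and \<open>k - i\<close>.\<close>

lemma P_linear_decay:
  assumes "Q 0 > 0" and "\<And>i. i < w \<Longrightarrow> Q i > 0 \<Longrightarrow> Q (Suc i) \<ge> Q i * (1 - \<eta>)"
  shows "i \<le> w \<Longrightarrow> Q i \<ge> Q 0 * (1 - real i * \<eta>) \<and> Q i \<ge> Q 0 / 2"
proof (induction i)
  case 0
  then show ?case using assms(1) by simp
next
  case (Suc i)
  have IH: "Q i \<ge> Q 0 * (1 - real i * \<eta>)" "Q i > 0" using Suc assms(1) by auto
  have half: "real j * \<eta> \<le> 1/2" if "j \<le> w" for j
    using mult_right_mono[of "real j" "real w" \<eta>] that eta_bounds by simp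
  have e1: "\<eta> \<le> 1" using half[of 1] Suc.prems by simp
  have "Q 0 * (1 - real (Suc i) * \<eta>) \<le> Q 0 * ((1 - real i * \<eta>) * (1 - \<eta>))"
    using assms(1) eta_bounds(1) by (intro mult_left_mono) (auto simp: algebra_simps)
  also have "\<dots> \<le> Q i * (1 - \<eta>)"
    using mult_right_mono[OF IH(1), of "1 - \<eta>"] e1 by (simp add: mult.assoc)
  also have "\<dots> \<le> Q (Suc i)" by (rule assms(2)) (use Suc.prems IH in auto)
  finally have 1: "Q (Suc i) \<ge> Q 0 * (1 - real (Suc i) * \<eta>)" .
  have "Q 0 * (1/2) \<le> Q 0 * (1 - real (Suc i) * \<eta>)"
    using half[OF Suc.prems] assms(1) by (intro mult_left_mono) auto
  with 1 show ?case by auto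
qed

text \<open>The sign of \<open>d k / (n - k) - m / k\<close> decides whether the window runs up or
  down. It has \<open>w + 1\<close> levels, all of index at most \<open>2 * k\<close> and with
  \<open>P\<close> at least \<open>P k / 2\<close>, so each contributes at least
  \<open>m * P k / (4 * k)\<close>.\<close>

lemma window_sum:
  "(\<Sum>K\<in>{1..n}. real m * P K / real K) \<ge> P k * (real (w + 1) * real m / (4 * real k))"
proof (cases "P k > 0")
  case False
  then have "P k = 0" using P_nonneg[of k] by linarith
  then show ?thesis using P_nonneg by (simp add: sum_nonneg)
next
  case True
  have k0: "real k > 0" "s > 0" "s \<le> real k" "real k - real m = s" using m_less s by auto
  have "80 * real w \<le> s"
    using w_small mult_right_mono[of 1 "real r" "real w"] r_pos k0 by simp
  then have wk: "w < k - m" "w < k" using m_less k0 by linarith+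
  obtain f where f: "inj_on f {0..w}" "f ` {0..w} \<subseteq> {1..n}"
    "\<And>i. i \<le> w \<Longrightarrow> f i \<le> 2 * k" "\<And>i. i \<le> w \<Longrightarrow> P (f i) \<ge> P k / 2"
  proof (cases "d k / (real n - real k) \<le> real m / real k")
    case q: True
    show ?thesis
    proof (rule that[of "\<lambda>i. k + i"])
      show "P (k + i) \<ge> P k / 2" if "i \<le> w" for i
        using P_linear_decay[of "\<lambda>i. P (k + i)" i] P_up_step[OF q] True that by auto
    qed (use wk n_large in \<open>auto simp: inj_on_def\<close>)
  next
    case False
    then have q: "d k / (real n - real k) \<ge> real m / real k" by simp
    show ?thesis
    proof (rule that[of "\<lambda>i. k - i"])
      show "P (k - i) \<ge> P k / 2" if "i \<le> w" for i
        using P_linear_decay[of "\<lambda>i. P (k - i)" i] P_down_step[OF q] True that by auto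
    qed (use wk n_large in \<open>auto simp: inj_on_def\<close>)
  qed
  have "P k * (real (w + 1) * real m / (4 * real k)) = (\<Sum>i\<in>{0..w}. real m * (P k / 2) / (2 * real k))"
    by simp
  also have "\<dots> \<le> (\<Sum>i\<in>{0..w}. real m * P (f i) / real (f i))"
  proof (rule sum_mono)
    fix i assume "i \<in> {0..w}"
    then have "f i \<in> {1..n}" "f i \<le> 2 * k" "P (f i) \<ge> P k / 2"
      using f(3,4) image_subset_iff[THEN iffD1, OF f(2)] by auto
    then show "real m * (P k / 2) / (2 * real k) \<le> real m * P (f i) / real (f i)"
      using True by (intro frac_le mult_left_mono) (auto simp: P_nonneg)
  qed
  also have "\<dots> = (\<Sum>K\<in>f ` {0..w}. real m * P K / real K)"
    using f(1) by (simp add: sum.reindex)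
  also have "\<dots> \<le> (\<Sum>K\<in>{1..n}. real m * P K / real K)"
    using f(2) by (intro sum_mono2) (auto simp: P_nonneg)
  finally show ?thesis .
qed

end

text \<open>Takes the longest window that \<open>window_sum\<close> permits,
  \<open>(k - m) / t\<close> rounded down. Its \<open>w + 1\<close> levels make up for the rounding,
  even when \<open>w = 0\<close>.\<close>

lemma profile_sum:
  "P k * ((real k - real m) / (4 * real k) * sqrt (real m / (8 * real r)))
     \<le> (\<Sum>K\<in>{1..n}. real m * P K / real K)"
proof -
  define t where "t = sqrt (8 * real r * real m)"
  define w where "w = nat \<lfloor>(real k - real m) / t\<rfloor>"
  have m0: "real m > 0" "real r > 0" using r_pos m_large by auto
  then have t: "t > 0" "t\<^sup>2 = 8 * real r * real m" by (simp_all add: t_def)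
  have w1: "real w \<le> (real k - real m) / t" "(real k - real m) / t \<le> real (w + 1)"
    using m_less t(1) unfolding w_def by (simp_all add: of_nat_floor) linarith+
  have "(real w * t)\<^sup>2 \<le> (real k - real m)\<^sup>2"
    using w1(1) t(1) by (intro power_mono) (auto simp: field_simps)
  then have w: "8 * real r * real m * (real w)\<^sup>2 \<le> (real k - real m)\<^sup>2"
    by (simp add: power_mult_distrib t(2) mult_ac)
  have "sqrt (real m / (8 * real r)) * t = real m"
    using m0 unfolding t_def by (simp add: real_sqrt_mult[symmetric])
  then have "sqrt (real m / (8 * real r)) = real m / t" using t(1) by (simp add: field_simps)
  then have "P k * ((real k - real m) / (4 * real k) * sqrt (real m / (8 * real r)))
      = P k * ((real k - real m) / t * real m / (4 * real k))" by simp
  also have "\<dots> \<le> P k * (real (w + 1) * real m / (4 * real k))"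
    using w1(2) by (intro mult_left_mono divide_right_mono mult_right_mono P_nonneg) auto
  also have "\<dots> \<le> (\<Sum>K\<in>{1..n}. real m * P K / real K)" by (rule window_sum[OF refl refl refl w])
  finally show ?thesis .
qed

end

section \<open>Sets with a prescribed number of edges\<close>

abbreviation edges_in :: "'a set set \<Rightarrow> 'a set \<Rightarrow> 'a set set" where
  "edges_in E S \<equiv> {e \<in> E. e \<subseteq> S}"

section \<open>Growth of the probability of having at least \<open>l\<close> edges\<close>

definition rich_sets :: "'a set \<Rightarrow> 'a set set \<Rightarrow> nat \<Rightarrow> nat \<Rightarrow> 'a set set" where
  "rich_sets V E K l = {S. S \<subseteq> V \<and> card S = K \<and> l \<le> card (edges_in E S)}"

text \<open>Counts pairs of a rich \<open>Suc K\<close>-set and one of its elements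
  \<open>v\<close>. Two disjoint kinds occur: those where deleting \<open>v\<close> leaves a rich
  set (\<open>?Y\<close>), and those where the set has exactly \<open>l\<close> edges and
  \<open>v\<close> lies on one of them (\<open>?Z\<close>), so that the deletion destroys an
  edge.\<close>

lemma rich_sets_step:
  assumes V: "finite V" and E: "finite E"
  shows "(card V - K) * card (rich_sets V E K l)
      + (\<Sum>A\<in>good_sets V E (Suc K) l. card (\<Union>(edges_in E A)))
    \<le> Suc K * card (rich_sets V E (Suc K) l)"
proof -
  let ?R = "\<lambda>K. rich_sets V E K l"
  let ?G = "good_sets V E (Suc K) l"
  let ?f = "\<lambda>(T, v). (insert v T, v)"
  let ?X = "SIGMA S:?R (Suc K). S"
  let ?Y = "?f ` (SIGMA T:?R K. V - T)"
  let ?Z = "SIGMA A:?G. \<Union>(edges_in E A)"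
  have fR: "finite (?R K)" for K
    by (rule finite_subset[of _ "Pow V"]) (use V in \<open>auto simp: rich_sets_def\<close>)
  have fG: "finite ?G" by (rule finite_good_sets[OF V])
  have fin: "finite S" if "S \<subseteq> V" for S using that V by (rule finite_subset)
  have fS: "finite S" if "S \<in> ?R K" for S K using that fin by (auto simp: rich_sets_def)
  have fU: "finite (\<Union>(edges_in E A))" if "A \<in> ?G" for A
    by (rule finite_subset[of _ A]) (use that fin in \<open>auto simp: good_sets_def\<close>)
  have fX: "finite ?X" using fR fS by (intro finite_SigmaI) auto
  have Y: "card ?Y = (card V - K) * card (?R K)"
  proof -
    have "inj_on ?f (SIGMA T:?R K. V - T)"
    proof (rule inj_onI)
      fix x y assume xy: "x \<in> (SIGMA T:?R K. V - T)" "y \<in> (SIGMA T:?R K. V - T)" "?f x = ?f y"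
      obtain A v A' v' where "x = (A, v)" "y = (A', v')" "v \<notin> A" "v' \<notin> A'"
        using xy by auto
      then show "x = y" using xy(3) insert_ident[of v A A'] by auto
    qed
    then have "card ?Y = card (SIGMA T:?R K. V - T)" by (rule card_image)
    also have "\<dots> = (\<Sum>T\<in>?R K. card (V - T))"
      by (rule card_SigmaI) (use fR V in auto)
    also have "\<dots> = (\<Sum>T\<in>?R K. card V - K)"
      by (rule sum.cong[OF refl]) (use fin in \<open>auto simp: rich_sets_def card_Diff_subset\<close>)
    finally show ?thesis by simp
  qed
  have Z: "card ?Z = (\<Sum>A\<in>?G. card (\<Union>(edges_in E A)))"
    by (rule card_SigmaI) (use fG fU in auto)
  have X: "card ?X = Suc K * card (?R (Suc K))"
  proof -
    have "card ?X = (\<Sum>S\<in>?R (Suc K). card S)" by (rule card_SigmaI) (use fR fS in auto)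
    also have "\<dots> = (\<Sum>S\<in>?R (Suc K). Suc K)" by (rule sum.cong) (auto simp: rich_sets_def)
    finally show ?thesis by simp
  qed
  have YX: "?Y \<subseteq> ?X"
  proof
    fix y assume "y \<in> ?Y"
    then obtain T v where T: "T \<subseteq> V" "card T = K" "l \<le> card (edges_in E T)" "v \<in> V" "v \<notin> T"
      and y: "y = (insert v T, v)" by (auto simp: rich_sets_def)
    have "card (edges_in E T) \<le> card (edges_in E (insert v T))"
      by (rule card_mono) (use E in auto)
    then show "y \<in> ?X" using T y fin[of T] by (auto simp: rich_sets_def)
  qed
  have ZX: "?Z \<subseteq> ?X" by (auto simp: good_sets_def rich_sets_def)
  have dis: "?Y \<inter> ?Z = {}"
  proof -
    have False if T: "T \<in> ?R K" "v \<notin> T" and A: "insert v T \<in> ?G" "v \<in> \<Union>(edges_in E (insert v T))" for T v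
    proof -
      obtain e where e: "e \<in> E" "v \<in> e" "e \<subseteq> insert v T" using A(2) by blast
      then have "edges_in E T \<subset> edges_in E (insert v T)" using T(2) by blast
      then have "card (edges_in E T) < card (edges_in E (insert v T))"
        by (rule psubset_card_mono[rotated]) (use E in simp)
      then show False using T(1) A(1) by (simp add: rich_sets_def good_sets_def)
    qed
    then show ?thesis by auto
  qed
  have "card ?Y + card ?Z = card (?Y \<union> ?Z)"
    by (rule card_Un_disjoint[symmetric]) (use dis finite_subset[OF YX fX] finite_subset[OF ZX fX] in auto)
  also have "\<dots> \<le> card ?X" by (rule card_mono[OF fX]) (use YX ZX in blast)
  finally show ?thesis unfolding X Y Z .
qed

lemma Suc_times_binomial_Suc: "Suc K * (n choose Suc K) = (n - K) * (n choose K)"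
  using binomial_absorb_comp[of n K] binomial_absorption[of K n] by simp

text \<open>After division by \<open>Suc K * (card V choose Suc K)\<close>,
  \<open>rich_sets_step\<close> bounds each summand by the increment of the probability of being
  rich. These increments telescope.\<close>

lemma sum_covered_le_1:
  assumes V: "finite V" and E: "finite E"
  shows "(\<Sum>K\<in>{1..card V}. (\<Sum>A\<in>good_sets V E K l. real (card (\<Union>(edges_in E A))))
      / (real K * real (card V choose K))) \<le> 1"
proof -
  let ?n = "card V"
  define \<phi> where "\<phi> K = real (card (rich_sets V E K l)) / real (?n choose K)" for K
  define t where "t K = (\<Sum>A\<in>good_sets V E K l. real (card (\<Union>(edges_in E A))))
      / (real K * real (?n choose K))" for K
  have "t (Suc K) \<le> \<phi> (Suc K) - \<phi> K" if K: "K < ?n" for K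
  proof -
    define c where "c = real (?n choose K)"
    define c' where "c' = real (?n choose Suc K)"
    have c: "c > 0" "c' > 0" using K by (simp_all add: c_def c'_def)
    have cc: "real (Suc K) * c' = real (?n - K) * c"
      using Suc_times_binomial_Suc[of K ?n] unfolding c_def c'_def of_nat_mult[symmetric] by simp
    let ?S = "\<Sum>A\<in>good_sets V E (Suc K) l. real (card (\<Union>(edges_in E A)))"
    have "real (?n - K) * real (card (rich_sets V E K l)) + ?S
        \<le> real (Suc K) * real (card (rich_sets V E (Suc K) l))"
      using rich_sets_step[OF V E, of K l]
      by (simp only: of_nat_mult[symmetric] of_nat_sum[symmetric] of_nat_add[symmetric] of_nat_le_iff)
    then have "(real (?n - K) * real (card (rich_sets V E K l)) + ?S) / (real (Suc K) * c')
        \<le> real (Suc K) * real (card (rich_sets V E (Suc K) l)) / (real (Suc K) * c')"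
      by (rule divide_right_mono) (use c in simp)
    also have "\<dots> = \<phi> (Suc K)" by (simp add: \<phi>_def c'_def del: of_nat_Suc)
    also have "(real (?n - K) * real (card (rich_sets V E K l)) + ?S) / (real (Suc K) * c')
        = real (?n - K) * real (card (rich_sets V E K l)) / (real (?n - K) * c) + t (Suc K)"
      by (simp only: add_divide_distrib cc t_def c'_def[symmetric])
    also have "\<dots> = \<phi> K + t (Suc K)" using K by (simp add: \<phi>_def c_def)
    finally show ?thesis by simp
  qed
  then have "(\<Sum>K<?n. t (Suc K)) \<le> (\<Sum>K<?n. \<phi> (Suc K) - \<phi> K)" by (intro sum_mono) auto
  also have "\<dots> = \<phi> ?n - \<phi> 0" by (rule sum_lessThan_telescope)
  also have "\<dots> \<le> 1"
  proof -
    have "rich_sets V E ?n l \<subseteq> {V}"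
      using card_subset_eq[OF V] unfolding rich_sets_def by blast
    then have "card (rich_sets V E ?n l) \<le> 1"
      using card_mono[of "{V}" "rich_sets V E ?n l"] by simp
    moreover have "\<phi> 0 \<ge> 0" by (simp add: \<phi>_def)
    ultimately show ?thesis by (simp add: \<phi>_def)
  qed
  also have "(\<Sum>K<?n. t (Suc K)) = (\<Sum>K\<in>{1..?n}. t K)"
    using sum.atLeast1_atMost_eq[of t ?n] by simp
  finally show ?thesis by (simp add: t_def)
qed

section \<open>Classes of vertex sets with a fixed edge set\<close>

definition edge_class :: "'a set \<Rightarrow> 'a set set \<Rightarrow> 'a set set \<Rightarrow> 'a set set" where
  "edge_class V E L = {A. A \<subseteq> V \<and> edges_in E A = L}"

text \<open>If adding \<open>v\<close> leaves the class, then some new edge \<open>e\<close> passes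
  through \<open>v\<close>. The witness is \<open>e - {v}\<close>: no set that contains
  \<open>e\<close> can have edge set \<open>L\<close>.\<close>

lemma edge_class_local_interval_family:
  assumes "hypergraph V E" "\<forall>e\<in>E. card e \<le> r" "L \<subseteq> E"
  shows "local_interval_family V (\<Union>L) (edge_class V E L) r"
proof
  show "finite V" using assms(1) by (simp add: hypergraph_def)
next
  fix A assume "A \<in> edge_class V E L"
  then show "\<Union>L \<subseteq> A \<and> A \<subseteq> V" by (auto simp: edge_class_def)
next
  fix A A' assume A: "A \<in> edge_class V E L" "\<Union>L \<subseteq> A'" "A' \<subseteq> A"
  then have "A \<subseteq> V" "edges_in E A = L" by (auto simp: edge_class_def)
  moreover have "edges_in E A' \<subseteq> edges_in E A" using A(3) by blast
  moreover have "L \<subseteq> edges_in E A'" using A(2) assms(3) by blast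
  ultimately show "A' \<in> edge_class V E L" using A(3) unfolding edge_class_def by blast
next
  fix A v assume A: "A \<in> edge_class V E L" and v: "v \<in> V - A" and ins: "insert v A \<notin> edge_class V E L"
  have A1: "A \<subseteq> V" "edges_in E A = L" using A by (auto simp: edge_class_def)
  have "edges_in E (insert v A) \<noteq> L" using ins A1 v by (auto simp: edge_class_def)
  then obtain e where e: "e \<in> E" "e \<subseteq> insert v A" "e \<notin> L" using A1(2) by blast
  then have ve: "v \<in> e" using A1(2) by blast
  have fe: "finite e" using e(1) assms(1) finite_subset by (auto simp: hypergraph_def)
  show "\<exists>T\<subseteq>A. card T < r \<and> (\<forall>A'. T \<subseteq> A' \<longrightarrow> v \<in> A' \<longrightarrow> A' \<notin> edge_class V E L)"
  proof (intro exI[of _ "e - {v}"] conjI allI impI)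
    show "e - {v} \<subseteq> A" using e by blast
    show "card (e - {v}) < r"
      using card_Diff1_less[OF fe ve] assms(2) e(1) by (meson less_le_trans)
    fix A' assume "e - {v} \<subseteq> A'" "v \<in> A'"
    then have "e \<in> edges_in E A'" using e(1) by blast
    then show "A' \<notin> edge_class V E L" using e(3) unfolding edge_class_def by blast
  qed
qed

context local_interval_family
begin

text \<open>Normalised by binomial coefficients, \<open>bad_pairs_eq\<close> becomes
  \<open>P_step\<close> and \<open>bad_pairs_step\<close> becomes \<open>d_step\<close>.\<close>

lemma smooth_profile_levels:
  assumes r: "r \<ge> 1" "card B \<ge> 1000 * r" "card B < k" "card V \<ge> 20 * k"
  shows "smooth_profile (\<lambda>K. real (card (level K)) / real (card V choose K))
    (\<lambda>K. real (bad_pairs K) / real (card (level K))) k (card B) (card V) r"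
proof
  let ?n = "card V" and ?m = "card B"
  let ?g = "\<lambda>K. real (card (level K))"
  show "?g K / real (?n choose K) \<ge> 0" for K by simp
  show "real (bad_pairs K) / ?g K \<ge> 0" for K by simp
  have gpos: "?g K > 0" if "?m \<le> K" "?g (Suc K) > 0" for K
    using level_nonempty_pred[of K] that finite_level by (simp add: card_gt_0_iff)
  show "?g K / real (?n choose K) > 0" if "?m \<le> K" "?g (Suc K) / real (?n choose Suc K) > 0" for K
  proof -
    have "?g (Suc K) > 0" "?n choose Suc K > 0" using that(2) by (auto simp: zero_less_divide_iff)
    then show ?thesis using gpos[OF that(1)] by (auto simp: zero_less_binomial_iff)
  qed
  show "?g (Suc K) / real (?n choose Suc K) * (1 - real ?m / real (Suc K))
      = ?g K / real (?n choose K) * (1 - real (bad_pairs K) / ?g K / (real ?n - real K))"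
    if K: "?m \<le> K" "K < ?n" for K
  \<comment> \<open>If level \<open>K\<close> is empty, so is the next one, and both sides are 0
    whatever the division by zero yields.\<close>
  proof (cases "?g K = 0")
    case True
    then show ?thesis using gpos[OF K(1)] by auto
  next
    case False
    define c where "c = real (?n choose K)"
    define c' where "c' = real (?n choose Suc K)"
    define N where "N = real ?n - real K"
    have c: "c > 0" "c' > 0" "N > 0" using K by (simp_all add: c_def c'_def N_def)
    have "real (Suc K) * c' = real (?n - K) * c"
      using Suc_times_binomial_Suc[of K ?n] unfolding c_def c'_def of_nat_mult[symmetric] by simp
    then have cc: "real (Suc K) * c' = N * c" using K by (simp add: N_def of_nat_diff)
    have g: "(real (Suc K) - real ?m) * ?g (Suc K) = N * ?g K - real (bad_pairs K)"
      using arg_cong[OF bad_pairs_eq[of K], of real] K by (simp add: N_def of_nat_diff)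
    have "?g (Suc K) / c' * (1 - real ?m / real (Suc K))
        = (real (Suc K) - real ?m) * ?g (Suc K) / (real (Suc K) * c')"
      using c by (simp add: field_simps)
    also have "\<dots> = (N * ?g K - real (bad_pairs K)) / (N * c)" unfolding g cc ..
    also have "\<dots> = ?g K / c * (1 - real (bad_pairs K) / ?g K / N)"
      using c False by (simp add: field_simps)
    finally show ?thesis by (simp only: c_def c'_def N_def)
  qed
  show "real (bad_pairs (Suc K)) / ?g (Suc K) * (1 - (real r - 1) / (real (Suc K) - real ?m))
      \<le> real (bad_pairs K) / ?g K"
    if K: "?m \<le> K" "K < ?n" "?g (Suc K) / real (?n choose Suc K) > 0" for K
  proof -
    define D D' g g' M where defs: "D = real (bad_pairs K)" "D' = real (bad_pairs (Suc K))"
      "g = ?g K" "g' = ?g (Suc K)" "M = real (Suc K) - real ?m"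
    have pos: "g' > 0" "g > 0" "M > 0"
      using K gpos[OF K(1)] by (auto simp: defs zero_less_divide_iff)
    have "(M - (real r - 1)) * D' * g \<le> M * g' * D"
      using bad_pairs_step[of K] K r by (simp add: defs)
    then have "D' / g' * (1 - (real r - 1) / M) \<le> D / g"
      using pos by (simp add: field_simps)
    then show ?thesis by (simp add: defs)
  qed
qed (use r in auto)

end

text \<open>\<open>c\<close> is a common lower bound for the factor in \<open>profile_sum\<close>.
  Summing that estimate over all \<open>L\<close> and exchanging the sums produces the quantity
  bounded in \<open>sum_covered_le_1\<close>.\<close>

lemma edge_prob_bound:
  fixes V :: "'a set"
  assumes H: "hypergraph V E" "\<forall>e\<in>E. card e \<le> r" and r: "r \<ge> 1" and n: "card V \<ge> 20 * k"
    and L: "\<And>L. L \<subseteq> E \<Longrightarrow> card L = l \<Longrightarrow> 1000 * r \<le> card (\<Union>L) \<and> card (\<Union>L) < k \<and>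
      c \<le> (real k - real (card (\<Union>L))) / (4 * real k) * sqrt (real (card (\<Union>L)) / (8 * real r))"
  shows "edge_prob V E k l * c \<le> 1"
proof -
  let ?n = "card V"
  have V: "finite V" using H by (simp add: hypergraph_def)
  have E: "finite E" by (rule finite_subset[of _ "Pow V"]) (use H V in \<open>auto simp: hypergraph_def\<close>)
  define LL where "LL = {L. L \<subseteq> E \<and> card L = l}"
  have fLL: "finite LL" using E by (simp add: LL_def)
  define g where "g L K = card {A \<in> edge_class V E L. card A = K}" for L K
  have cls: "{A \<in> good_sets V E K l. edges_in E A = L} = {A \<in> edge_class V E L. card A = K}"
    if "L \<in> LL" for L K
    using that by (auto simp: LL_def good_sets_def edge_class_def)
  \<comment> \<open>Needed for two weights: the constant 1 at size \<open>k\<close>, which counts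
    the good sets, and the size of the union of the edges at every size \<open>K\<close>.\<close>
  have grp: "(\<Sum>A\<in>good_sets V E K l. h (edges_in E A)) = (\<Sum>L\<in>LL. h L * real (g L K))"
    for h :: "'a set set \<Rightarrow> real" and K
  proof -
    have "(\<Sum>A\<in>good_sets V E K l. h (edges_in E A))
        = (\<Sum>L\<in>LL. \<Sum>A\<in>{A \<in> good_sets V E K l. edges_in E A = L}. h (edges_in E A))"
      by (rule sum.group[symmetric]) (use finite_good_sets[OF V] fLL in \<open>auto simp: LL_def good_sets_def\<close>)
    also have "\<dots> = (\<Sum>L\<in>LL. h L * real (g L K))"
      by (rule sum.cong[OF refl]) (simp add: cls g_def, simp add: edge_class_def)
    finally show ?thesis .
  qed
  have "edge_prob V E k l * c = (\<Sum>L\<in>LL. real (g L k) / real (?n choose k) * c)"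
    using edge_prob_eq[OF V, of k E l] n grp[of "\<lambda>_. 1" k]
    by (simp add: sum_divide_distrib sum_distrib_right)
  also have "\<dots> \<le> (\<Sum>L\<in>LL. \<Sum>K\<in>{1..?n}. real (card (\<Union>L)) * (real (g L K) / real (?n choose K)) / real K)"
  proof (rule sum_mono)
    fix L assume "L \<in> LL"
    then have L': "L \<subseteq> E" "card L = l" by (auto simp: LL_def)
    interpret local_interval_family V "\<Union>L" "edge_class V E L" r
      by (rule edge_class_local_interval_family[OF H L'(1)])
    have lev: "g L K = card (level K)" for K by (simp add: g_def level_def)
    note Lb = L[OF L']
    interpret smooth_profile "\<lambda>K. real (card (level K)) / real (?n choose K)"
      "\<lambda>K. real (bad_pairs K) / real (card (level K))" k "card (\<Union>L)" ?n r
      by (rule smooth_profile_levels) (use Lb r n in auto)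
    have "real (g L k) / real (?n choose k) * c \<le> real (g L k) / real (?n choose k) *
        ((real k - real (card (\<Union>L))) / (4 * real k) * sqrt (real (card (\<Union>L)) / (8 * real r)))"
      using Lb by (intro mult_left_mono) auto
    also have "\<dots> \<le> (\<Sum>K\<in>{1..?n}. real (card (\<Union>L)) * (real (g L K) / real (?n choose K)) / real K)"
      using profile_sum by (simp add: lev)
    finally show "real (g L k) / real (?n choose k) * c
        \<le> (\<Sum>K\<in>{1..?n}. real (card (\<Union>L)) * (real (g L K) / real (?n choose K)) / real K)" .
  qed
  also have "\<dots> = (\<Sum>K\<in>{1..?n}. \<Sum>L\<in>LL. real (card (\<Union>L)) * (real (g L K) / real (?n choose K)) / real K)"
    by (rule sum.swap)
  also have "\<dots> = (\<Sum>K\<in>{1..?n}. (\<Sum>A\<in>good_sets V E K l. real (card (\<Union>(edges_in E A))))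
      / (real K * real (?n choose K)))"
    unfolding grp[of "\<lambda>L. real (card (\<Union>L))"] sum_divide_distrib
    by (intro sum.cong refl) (simp add: mult_ac)
  also have "\<dots> \<le> 1" by (rule sum_covered_le_1[OF V E])
  finally show ?thesis .
qed

section \<open>How many vertices \<open>l\<close> edges must cover\<close>

lemma sum_binomial_le_power:
  assumes "1 \<le> r" "r \<le> m"
  shows "real (\<Sum>i\<le>r. m choose i) \<le> (3 * real m / real r) ^ r"
proof -
  \<comment> \<open>With \<open>?x \<le> 1\<close>, weighting the terms by \<open>?x ^ i\<close>
    instead of \<open>?x ^ r\<close> only enlarges the sum. The full binomial sum is then
    \<open>(1 + ?x) ^ m\<close>, at most \<open>exp r\<close> for this choice of
    \<open>?x\<close>.\<close>
  let ?x = "real r / real m"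
  have x: "0 < ?x" "?x \<le> 1" using assms by auto
  have "real (\<Sum>i\<le>r. m choose i) * ?x ^ r \<le> (\<Sum>i\<le>r. real (m choose i) * ?x ^ i)"
    unfolding of_nat_sum sum_distrib_right
    by (intro sum_mono mult_left_mono power_decreasing) (use x in auto)
  also have "\<dots> \<le> (\<Sum>i\<le>m. real (m choose i) * ?x ^ i)"
    by (rule sum_mono2) (use assms in auto)
  also have "\<dots> = (?x + 1) ^ m" by (simp add: binomial_ring)
  also have "\<dots> \<le> exp ?x ^ m"
    using exp_ge_add_one_self[of ?x] by (intro power_mono) (auto simp: add.commute)
  also have "\<dots> = exp (real r)" using assms by (simp add: exp_of_nat_mult[symmetric])
  also have "\<dots> = exp 1 ^ r" by (simp add: exp_of_nat_mult[symmetric])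
  also have "\<dots> \<le> 3 ^ r" by (intro power_mono exp_le) simp
  finally have "real (\<Sum>i\<le>r. m choose i) \<le> 3 ^ r / ?x ^ r"
    using x by (simp add: pos_le_divide_eq)
  also have "\<dots> = (3 * real m / real r) ^ r" by (simp add: power_divide power_mult_distrib)
  finally show ?thesis .
qed

lemma card_edges_le:
  assumes "finite L" "\<forall>e\<in>L. finite e \<and> card e \<le> r"
  shows "card L \<le> (\<Sum>i\<le>r. card (\<Union>L) choose i)"
proof -
  let ?B = "\<Union>L"
  have B: "finite ?B" using assms by auto
  have "L \<subseteq> (\<Union>i\<le>r. {e. e \<subseteq> ?B \<and> card e = i})" using assms by auto
  then have "card L \<le> card (\<Union>i\<le>r. {e. e \<subseteq> ?B \<and> card e = i})"
    using B by (intro card_mono) auto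
  also have "\<dots> \<le> (\<Sum>i\<le>r. card {e. e \<subseteq> ?B \<and> card e = i})" by (rule card_UN_le) simp
  also have "\<dots> = (\<Sum>i\<le>r. card ?B choose i)" by (simp add: n_subsets[OF B])
  finally show ?thesis .
qed

text \<open>A union of fewer than \<open>r\<close> vertices has too few subsets for
  \<open>10000 ^ r\<close> edges, so \<open>sum_binomial_le_power\<close> applies. Comparing
  \<open>r\<close>-th powers gives \<open>10000 \<le> 3 * m / r\<close>, more than is needed for
  \<open>m_large\<close>.\<close>

lemma card_Union_edges_large:
  assumes "finite L" "\<forall>e\<in>L. finite e \<and> card e \<le> r" "r \<ge> 1" "10000 ^ r \<le> card L"
  shows "real (card L) \<le> (3 * real (card (\<Union>L)) / real r) ^ r" "1000 * r \<le> card (\<Union>L)"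
proof -
  let ?m = "card (\<Union>L)"
  have rm: "r \<le> ?m"
  proof (rule ccontr)
    assume "\<not> r \<le> ?m"
    have B: "finite (\<Union>L)" using assms by auto
    have "card L \<le> card (Pow (\<Union>L))" using B by (intro card_mono) auto
    also have "\<dots> = 2 ^ ?m" using B by (simp add: card_Pow)
    also have "\<dots> < 2 ^ r" using \<open>\<not> r \<le> ?m\<close> by simp
    also have "\<dots> \<le> (10000::nat) ^ r" by (intro power_mono) auto
    finally show False using assms by simp
  qed
  have "real (card L) \<le> real (\<Sum>i\<le>r. ?m choose i)" using card_edges_le[OF assms(1,2)] by (rule of_nat_mono)
  also have "\<dots> \<le> (3 * real ?m / real r) ^ r" by (rule sum_binomial_le_power[OF assms(3) rm])
  finally show *: "real (card L) \<le> (3 * real ?m / real r) ^ r" .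
  have "(10000::real) ^ r \<le> real (card L)" using of_nat_mono[OF assms(4), where ?'a = real] by simp
  then have "(10000::real) ^ r \<le> (3 * real ?m / real r) ^ r" using * by linarith
  then have "10000 \<le> 3 * real ?m / real r"
    using assms(3) by (subst (asm) power_mono_iff) auto
  then show "1000 * r \<le> ?m" using assms(3) by (simp add: field_simps)
qed

lemma card_Union_edges_le:
  assumes "finite L" "\<forall>e\<in>L. card e \<le> r"
  shows "card (\<Union>L) \<le> r * card L"
proof -
  have "card (\<Union>L) \<le> (\<Sum>e\<in>L. card e)" by (rule card_Union_le_sum_card)
  also have "\<dots> \<le> (\<Sum>e\<in>L. r)" using assms(2) by (intro sum_mono) auto
  finally show ?thesis by (simp add: mult.commute)
qed

section \<open>The bound\<close>

text \<open>Here \<open>x\<close> is \<open>l\<close> to the power \<open>1 / (2 * r)\<close>. With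
  \<open>m \<le> k / 2\<close> the first factor is at least 1/8, and the second at least
  \<open>x / 5\<close> because \<open>3 / 25 \<le> 1 / 8\<close>.\<close>

lemma root_bound_small_cover:
  fixes x m k r :: real
  assumes "x \<ge> 0" "x\<^sup>2 \<le> 3 * m / r" "r > 0" "m \<ge> 0" "k > 0" "m \<le> k / 2"
  shows "x / 100 \<le> (k - m) / (4 * k) * sqrt (m / (8 * r))"
proof -
  have "x\<^sup>2 * r \<le> 3 * m" using assms(2,3) by (simp add: field_simps)
  then have "(x / 5)\<^sup>2 \<le> m / (8 * r)"
    using assms(3,4) by (simp add: power_divide pos_le_divide_eq pos_divide_le_eq mult_ac)
  then have 1: "x / 5 \<le> sqrt (m / (8 * r))" by (rule real_le_rsqrt)
  have 2: "1 / 8 \<le> (k - m) / (4 * k)" using assms(5,6) by (simp add: field_simps)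
  have "x / 100 \<le> 1 / 8 * (x / 5)" using assms(1) by simp
  also have "\<dots> \<le> (k - m) / (4 * k) * sqrt (m / (8 * r))"
    by (rule mult_mono[OF 2 1]) (use assms in auto)
  finally show ?thesis .
qed

text \<open>Now the first factor is only known to be at least \<open>\<epsilon> / 4\<close>, but the
  second has order \<open>sqrt (k / r)\<close> while \<open>x\<close> is at most the fourth root
  \<open>y\<close> of \<open>k\<close>. The lower bound on \<open>k\<close> is equivalent to
  \<open>sqrt r \<le> \<epsilon> * y\<close>, which absorbs the loss.\<close>

lemma root_bound_large_cover:
  fixes x m k r \<epsilon> :: real
  assumes "x \<le> k powr (1/4)" "r > 0" "k > 0" "m \<ge> k / 2" "m \<le> (1 - \<epsilon>) * k" "\<epsilon> > 0" "k \<ge> r\<^sup>2 / \<epsilon> ^ 4"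
  shows "x / 100 \<le> (k - m) / (4 * k) * sqrt (m / (8 * r))"
proof -
  define y where "y = k powr (1/4)"
  have y: "y > 0" using assms(3) by (simp add: y_def)
  have y2: "sqrt k = y\<^sup>2"
    using assms(3) by (simp add: y_def powr_half_sqrt[symmetric] powr_powr[symmetric] powr_power)
  have y4: "y ^ 4 = k" using assms(3) by (simp add: y_def powr_power)
  have "(sqrt r / \<epsilon>) ^ 4 = r\<^sup>2 / \<epsilon> ^ 4"
    using assms(2) by (simp add: power_divide power4_eq_xxxx power2_eq_square)
  then have "(sqrt r / \<epsilon>) ^ 4 \<le> y ^ 4" using assms(7) y4 by simp
  then have "sqrt r / \<epsilon> \<le> y" by (rule power_mono_iff[THEN iffD1, rotated 3]) (use y assms in auto)
  then have ry: "sqrt r \<le> \<epsilon> * y" using assms(6) by (simp add: field_simps)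
  have 1: "\<epsilon> / 4 \<le> (k - m) / (4 * k)" using assms(3,5) by (simp add: field_simps)
  have "sqrt (k / (16 * r)) = y\<^sup>2 / (4 * sqrt r)"
    by (simp add: real_sqrt_divide real_sqrt_mult y2)
  moreover have "sqrt (k / (16 * r)) \<le> sqrt (m / (8 * r))"
    using assms(2,4) by (simp add: field_simps)
  ultimately have 2: "y\<^sup>2 / (4 * sqrt r) \<le> sqrt (m / (8 * r))" by simp
  have "x / 100 \<le> y / 16" using assms(1) y unfolding y_def[symmetric] by simp
  also have "\<dots> \<le> \<epsilon> / 4 * (y\<^sup>2 / (4 * sqrt r))"
  proof -
    have "y * sqrt r \<le> y * (\<epsilon> * y)" using ry y by (intro mult_left_mono) auto
    then show ?thesis using assms(2) by (simp add: field_simps power2_eq_square)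
  qed
  also have "\<dots> \<le> (k - m) / (4 * k) * sqrt (m / (8 * r))"
    by (rule mult_mono[OF 1 2]) (use assms in \<open>auto intro: divide_nonneg_nonneg order_trans[OF _ 1]\<close>)
  finally show ?thesis .
qed

lemma edge_prob_le_power:
  assumes H: "hypergraph V E" "\<forall>e\<in>E. card e \<le> r" and r: "r \<ge> 3" and \<epsilon>: "\<epsilon> > 0"
    and k: "real k \<ge> (real r)\<^sup>2 / \<epsilon> ^ 4" and n: "card V \<ge> 20 * k"
    and l: "1 \<le> l" "real l \<le> (1 - \<epsilon>) * real k / real r"
  shows "edge_prob V E k l \<le> 100 * real l powr (- 1 / (2 * real r))"
proof -
  define x where "x = real l powr (1 / (2 * real r))"
  have x: "x > 0" "real l powr (- 1 / (2 * real r)) = 1 / x"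
    using l(1) by (simp_all add: x_def powr_minus_divide)
  have k0: "real k > 0"
  proof -
    have "(real r)\<^sup>2 / \<epsilon> ^ 4 > 0" using r \<epsilon> by simp
    then show ?thesis using k by linarith
  qed
  have xr: "x ^ (2 * r) = real l" and x2: "(x\<^sup>2) ^ r = real l"
    using r l(1) by (simp_all add: x_def powr_power power_mult[symmetric])
  show ?thesis
  \<comment> \<open>As \<open>10000 = 100 * 100\<close>, smaller \<open>l\<close> give
    \<open>x \<le> 100\<close>, and the claimed bound is then at least 1.\<close>
  proof (cases "10000 ^ r \<le> l")
    case False
    then have "x ^ (2 * r) \<le> (100::real) ^ (2 * r)"
      unfolding xr by (simp add: power_mult)
    then have "x \<le> 100"
      using x(1) r by (subst (asm) power_mono_iff) auto
    then have "1 \<le> 100 * real l powr (- 1 / (2 * real r))" unfolding x(2) using x(1) by simp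
    then show ?thesis unfolding edge_prob_def using measure_pmf.prob_le_1 order_trans by blast
  next
    case True
    have lk: "real r * real l \<le> (1 - \<epsilon>) * real k" using l(2) r by (simp add: field_simps)
    have "edge_prob V E k l * (x / 100) \<le> 1"
    proof (rule edge_prob_bound[OF H _ n])
      fix L assume L: "L \<subseteq> E" "card L = l"
      let ?m = "card (\<Union>L)"
      have fL: "finite L" using L(2) l(1) by (intro card_ge_0_finite) simp
      have eL: "\<forall>e\<in>L. finite e \<and> card e \<le> r"
        using L(1) H finite_subset unfolding hypergraph_def by blast
      have large: "real l \<le> (3 * real ?m / real r) ^ r" "1000 * r \<le> ?m"
        using card_Union_edges_large[OF fL eL] r True L(2) by auto
      have "?m \<le> r * l" using card_Union_edges_le[OF fL, of r] eL L(2) by auto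
      then have mk: "real ?m \<le> (1 - \<epsilon>) * real k" using lk by (metis of_nat_mono of_nat_mult order_trans)
      also have "\<dots> < 1 * real k" using \<epsilon> k0 by (intro mult_strict_right_mono) auto
      finally have "?m < k" by simp
      have "(x\<^sup>2) ^ r \<le> (3 * real ?m / real r) ^ r" unfolding x2 by (rule large(1))
      then have xm: "x\<^sup>2 \<le> 3 * real ?m / real r" using r by (subst (asm) power_mono_iff) auto
      have "x / 100 \<le> (real k - real ?m) / (4 * real k) * sqrt (real ?m / (8 * real r))"
      proof (cases "real ?m \<le> real k / 2")
        case True
        then show ?thesis using root_bound_small_cover[OF _ xm] x(1) r k0 by simp
      next
        case False
        have "real l \<le> real k"
        proof -
          have "1 * real l \<le> real r * real l" using r by (intro mult_right_mono) auto
          also have "\<dots> \<le> 1 * real k" using lk mult_right_mono[of "1 - \<epsilon>" 1 "real k"] \<epsilon> by simp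
          finally show ?thesis by simp
        qed
        then have "x \<le> real k powr (1 / (2 * real r))"
          unfolding x_def by (intro powr_mono2) auto
        \<comment> \<open>Since \<open>r \<ge> 3\<close>, the exponent \<open>1 / (2 * r)\<close> is
          below 1/4.\<close>
        also have "\<dots> \<le> real k powr (1/4)"
          using r k0 by (intro powr_mono) (auto simp: field_simps)
        finally show ?thesis
          using root_bound_large_cover[of x k r ?m \<epsilon>] r k0 False mk \<epsilon> k by simp
      qed
      with large(2) \<open>?m < k\<close> show "1000 * r \<le> ?m \<and> ?m < k \<and>
          x / 100 \<le> (real k - real ?m) / (4 * real k) * sqrt (real ?m / (8 * real r))" by simp
    qed (use r k0 in auto)
    then show ?thesis unfolding x(2) using x(1) by (simp add: field_simps)
  qed
qed

lemma I_unif_eq: "I_unif r n k l = Max (edge_probs (\<lambda>e. card e = r) n k l)"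
  and I_atmost_eq: "I_atmost r n k l = Max (edge_probs (\<lambda>e. card e \<le> r) n k l)"
  by (simp_all add: I_unif_def I_atmost_def edge_probs_def)

theorem theorem1p5:
  fixes r :: nat and \<epsilon> :: real
  assumes "r \<ge> 3" and "\<epsilon> > 0"
  shows "\<exists>k0::nat. \<forall>k\<ge>k0. \<forall>l::nat.
           1 \<le> l \<and> real l \<le> (1 - \<epsilon>) * real k / real r \<longrightarrow>
             ind_unif r k l \<le> ind_atmost r k l \<and>
             ind_atmost r k l \<le> 100 * real l powr (- 1 / (2 * real r))"
\<comment> \<open>The threshold is the lower bound on \<open>k\<close> that
  \<open>root_bound_large_cover\<close> requires; it does not depend on \<open>l\<close>.\<close>
proof (intro exI[of _ "nat \<lceil>(real r)\<^sup>2 / \<epsilon> ^ 4\<rceil>"] allI impI conjI)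
  fix k l :: nat
  assume "nat \<lceil>(real r)\<^sup>2 / \<epsilon> ^ 4\<rceil> \<le> k" and l: "1 \<le> l \<and> real l \<le> (1 - \<epsilon>) * real k / real r"
  then have k: "real k \<ge> (real r)\<^sup>2 / \<epsilon> ^ 4" by linarith
  have lim_unif: "(\<lambda>n. I_unif r n k l) \<longlonglongrightarrow> ind_unif r k l"
    and lim_atmost: "(\<lambda>n. I_atmost r n k l) \<longlonglongrightarrow> ind_atmost r k l"
    unfolding ind_unif_def ind_atmost_def
    using convergent_I_unif convergent_I_atmost by (simp_all add: convergent_LIMSEQ_iff)
  show "ind_unif r k l \<le> ind_atmost r k l"
  proof (rule LIMSEQ_le[OF lim_unif lim_atmost], intro exI[of _ k] allI impI)
    fix n assume n: "k \<le> n"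
    have "edge_probs (\<lambda>e. card e = r) n k l \<subseteq> edge_probs (\<lambda>e. card e \<le> r) n k l"
    proof
      fix y assume "y \<in> edge_probs (\<lambda>e. card e = r) n k l"
      then obtain V :: "nat set" and E where "y = edge_prob V E k l" "hypergraph V E"
        "card V = n" "\<forall>e\<in>E. card e = r"
        unfolding edge_probs_def by blast
      then show "y \<in> edge_probs (\<lambda>e. card e \<le> r) n k l"
        unfolding edge_probs_def mem_Collect_eq by (intro exI[of _ V] exI[of _ E]) simp
    qed
    with n show "I_unif r n k l \<le> I_atmost r n k l"
      unfolding I_unif_eq I_atmost_eq
      by (intro Max_mono edge_probs_nonempty finite_edge_probs)
  qed
  show "ind_atmost r k l \<le> 100 * real l powr (- 1 / (2 * real r))"
  \<comment> \<open>The bound holds for every \<open>n \<ge> 20 * k\<close>, the size at which the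
    window estimate applies, and so passes to the limit.\<close>
  proof (rule LIMSEQ_le_const2[OF lim_atmost], intro exI[of _ "20 * k"] allI impI)
    fix n assume n: "20 * k \<le> n"
    have "y \<le> 100 * real l powr (- 1 / (2 * real r))" if "y \<in> edge_probs (\<lambda>e. card e \<le> r) n k l" for y
      using that edge_prob_le_power[OF _ _ assms k] n l by (auto simp: edge_probs_def)
    then show "I_atmost r n k l \<le> 100 * real l powr (- 1 / (2 * real r))"
      unfolding I_atmost_eq using n
      by (intro Max.boundedI edge_probs_nonempty finite_edge_probs) auto
  qed
qed

end
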